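(* Let $d\ge1$ and let $\mathbf y=(y_w)_{w\in\mathcal W_{2d}}$, $y_w\in\mathbb H$, be a truncated quaternionic pseudo-moment sequence with $y_1=1$ satisfying the flatness condition $$\mathbf M_d(\mathbf y)\succeq0,\qquad\operatorname{rank}_{\mathbb H}\mathbf M_d(\mathbf y)=\operatorname{rank}_{\mathbb H}\mathbf M_{d-1}(\mathbf y)=r.$$ Let $(\mathscr H,\pi,\xi)$ be the canonical flat representation of $\mathbf y$ and assume the scalar-consistency condition $\pi(\mathcal I_n^{\mathbb R})=0$. Then there exist distinct points $\mathbf q^{(1)},\dots,\mathbf q^{(N)}\in\mathbb H^n$, $N\le r$, and weights $\lambda_1,\dots,\lambda_N>0$ with $\sum_{\nu=1}^N\lambda_\nu=1$, such that $\mu=\sum_{\nu=1}^N\lambda_\nu\delta_{\mathbf q^{(\nu)}}$ is a positive atomic probability measure representing $\mathbf y$.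
   Context: $\mathbb H$ is the skew field of quaternions, $\mathcal R(a)$ the real part. Fix $n\ge1$ and letters $q_1,\dots,q_n,\bar q_1,\dots,\bar q_n$. $\mathcal W$ is the set of words (including the empty word $1$) in these letters; $|w|$ is the length, $\mathcal W_t$ the words of length at most $t$; $w^*$ is obtained by reversing $w$ and exchanging $q_i\leftrightarrow\bar q_i$. $\mathcal F_n=\mathbb R\langle\mathbf q,\bar{\mathbf q}\rangle$ is the free real $*$-algebra spanned by words. $\mathcal I_n^{\mathbb R}$ is the ideal of all $p\in\mathcal F_n$ vanishing under every evaluation $q_i\mapsto a_i$, $\bar q_i\mapsto\bar a_i$, $\mathbf a\in\mathbb H^n$. Every word has a normal form $\prod_i|q_i|^{2\alpha_i}\tilde w$ obtained by writing consecutive factors $q_i\bar q_i$ or $\bar q_iq_i$ as $|q_i|^2$ and moving them to the front until $\tilde w$ contains no such factor; moments $y_w$ depend only on the normal form of $w$. Words $u,v$ are cyclically equivalent if $u=w_1w_2$, $v=w_2w_1$ for some words $w_1,w_2$. $\mathbf y=(y_w)_{w\in\mathcal W_{2d}}$ is a truncated quaternionic pseudo-moment sequence if $y_w=\overline{y_{w^*}}$ for $w\in\mathcal W_{2d}$ and $\mathcal R(y_u)=\mathcal R(y_v)$ for cyclically equivalent $u,v\in\mathcal W_{2d}$. $L_{\mathbf y}(\sum p_ww)=\sum p_wy_w\in\mathbb H$ for real-coefficient polynomials of degree at most $2d$. $[\mathbf M_t(\mathbf y)]_{u,v}=y_{u^*v}$, $u,v\in\mathcal W_t$, $t\le d$;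 $\succeq0$ means Hermitian with nonnegative quadratic form on quaternionic vectors; $\operatorname{rank}_{\mathbb H}$ is the quaternionic (right column) rank. Canonical flat representation. Under the flatness condition, choose vectors $\boldsymbol v_w$, $w\in\mathcal W_d$, spanning a right quaternionic Hilbert space $\mathscr H$ of $\mathbb H$-dimension $r$ (inner product conjugate-linear in the first, right-linear in the second argument) with $\langle\boldsymbol v_u,\boldsymbol v_v\rangle=y_{u^*v}$. By flatness $\mathscr H=\operatorname{span}_{\mathbb H}\{\boldsymbol v_w:w\in\mathcal W_{d-1}\}$. For each letter $a$, the rule $X_a\boldsymbol v_w=\boldsymbol v_{aw}$ ($w\in\mathcal W_{d-1}$) gives a well-defined right-$\mathbb H$-linear operator on $\mathscr H$, with $X_{a^*}=X_a^*$. $\pi:\mathcal F_n\to B_{\mathbb H}(\mathscr H)$ (right-$\mathbb H$-linear operators) is the unital real $*$-representation with $\pi(a_1\cdots a_m)=X_{a_1}\cdots X_{a_m}$ for letters $a_s$, and $\xi=\boldsymbol v_1$. A measure $\mu$ represents $\mathbf y$ if $y_w=\int w(\mathbf a,\bar{\mathbf a})\,d\mu(\mathbf a)$ for all $w\in\mathcal W_{2d}$. *)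

theory Defs
  imports "HOL-Probability.Probability" "HOL-Library.Poly_Mapping"
begin

section \<open>Quaternions\<close>

datatype quat = Quat (qRe: real) (qI: real) (qJ: real) (qK: real)

lemma quat_eq_iff:
  "x = y \<longleftrightarrow> qRe x = qRe y \<and> qI x = qI y \<and> qJ x = qJ y \<and> qK x = qK y"
  by (cases x; cases y) simp

instantiation quat :: ab_group_add
begin
definition "0 = Quat 0 0 0 0"
definition "x + y = Quat (qRe x + qRe y) (qI x + qI y) (qJ x + qJ y) (qK x + qK y)"
definition "- x = Quat (- qRe x) (- qI x) (- qJ x) (- qK x)"
definition "x - y = Quat (qRe x - qRe y) (qI x - qI y) (qJ x - qJ y) (qK x - qK y)"
instance
  by standard
    (simp_all add: quat_eq_iff zero_quat_def plus_quat_def uminus_quat_def minus_quat_def)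
end

lemma quat_add_sel [simp]:
  "qRe 0 = 0" "qI 0 = 0" "qJ 0 = 0" "qK 0 = 0"
  "qRe (x + y) = qRe x + qRe y" "qI (x + y) = qI x + qI y"
  "qJ (x + y) = qJ x + qJ y" "qK (x + y) = qK x + qK y"
  "qRe (- x) = - qRe x" "qI (- x) = - qI x" "qJ (- x) = - qJ x" "qK (- x) = - qK x"
  "qRe (x - y) = qRe x - qRe y" "qI (x - y) = qI x - qI y"
  "qJ (x - y) = qJ x - qJ y" "qK (x - y) = qK x - qK y"
  by (simp_all add: zero_quat_def plus_quat_def uminus_quat_def minus_quat_def)

instantiation quat :: real_vector
begin
definition "scaleR r x = Quat (r * qRe x) (r * qI x) (r * qJ x) (r * qK x)"
instance
  by standard (simp_all add: quat_eq_iff scaleR_quat_def algebra_simps)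
end

lemma quat_scaleR_sel [simp]:
  "qRe (r *\<^sub>R x) = r * qRe x" "qI (r *\<^sub>R x) = r * qI x"
  "qJ (r *\<^sub>R x) = r * qJ x" "qK (r *\<^sub>R x) = r * qK x"
  by (simp_all add: scaleR_quat_def)

instantiation quat :: real_algebra_1
begin
definition "1 = Quat 1 0 0 0"
definition "x * y = Quat
  (qRe x * qRe y - qI x * qI y - qJ x * qJ y - qK x * qK y)
  (qRe x * qI y + qI x * qRe y + qJ x * qK y - qK x * qJ y)
  (qRe x * qJ y - qI x * qK y + qJ x * qRe y + qK x * qI y)
  (qRe x * qK y + qI x * qJ y - qJ x * qI y + qK x * qRe y)"
instance
  by standard
    (simp_all add: quat_eq_iff one_quat_def times_quat_def algebra_simps)
end

lemma quat_mult_sel [simp]: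
  "qRe 1 = 1" "qI 1 = 0" "qJ 1 = 0" "qK 1 = 0"
  "qRe (x * y) = qRe x * qRe y - qI x * qI y - qJ x * qJ y - qK x * qK y"
  "qI (x * y) = qRe x * qI y + qI x * qRe y + qJ x * qK y - qK x * qJ y"
  "qJ (x * y) = qRe x * qJ y - qI x * qK y + qJ x * qRe y + qK x * qI y"
  "qK (x * y) = qRe x * qK y + qI x * qJ y - qJ x * qI y + qK x * qRe y"
  by (simp_all add: one_quat_def times_quat_def)

instantiation quat :: real_inner
begin
definition "inner x y = qRe x * qRe y + qI x * qI y + qJ x * qJ y + qK x * qK y"
definition "norm x = sqrt ((qRe x)\<^sup>2 + (qI x)\<^sup>2 + (qJ x)\<^sup>2 + (qK x)\<^sup>2)"
definition "sgn x = x /\<^sub>R norm (x :: quat)"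
definition "dist x y = norm (x - y :: quat)"
definition [code del]:
  "(uniformity :: (quat \<times> quat) filter) = (INF e\<in>{0 <..}. principal {(x, y). dist x y < e})"
definition [code del]:
  "open (U :: quat set) \<longleftrightarrow> (\<forall>x\<in>U. eventually (\<lambda>(x', y). x' = x \<longrightarrow> y \<in> U) uniformity)"
instance
proof
  fix x y z :: quat and r :: real and U :: "quat set"
  show "dist x y = norm (x - y)" by (rule dist_quat_def)
  show "sgn x = x /\<^sub>R norm x" by (rule sgn_quat_def)
  show "(uniformity :: (quat \<times> quat) filter) = (INF e\<in>{0 <..}. principal {(x, y). dist x y < e})"
    by (rule uniformity_quat_def)
  show "open U \<longleftrightarrow> (\<forall>x\<in>U. eventually (\<lambda>(x', y). x' = x \<longrightarrow> y \<in> U) uniformity)"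
    by (rule open_quat_def)
  show "inner x y = inner y x" by (simp add: inner_quat_def mult.commute)
  show "inner (x + y) z = inner x z + inner y z" by (simp add: inner_quat_def algebra_simps)
  show "inner (r *\<^sub>R x) y = r * inner x y" by (simp add: inner_quat_def algebra_simps)
  show "0 \<le> inner x x" by (simp add: inner_quat_def)
  show "inner x x = 0 \<longleftrightarrow> x = 0"
    by (simp add: inner_quat_def quat_eq_iff add_nonneg_eq_0_iff)
  show "norm x = sqrt (inner x x)"
    by (simp add: inner_quat_def norm_quat_def power2_eq_square)
qed
end

instantiation quat :: euclidean_space
begin
definition "Basis = {Quat 1 0 0 0, Quat 0 1 0 0, Quat 0 0 1 0, Quat 0 0 0 1}"
instance
proof
  show "(Basis :: quat set) \<noteq> {}" "finite (Basis :: quat set)"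
    by (simp_all add: Basis_quat_def)
  fix u v x :: quat
  show "(\<forall>u\<in>Basis. inner x u = 0) \<longleftrightarrow> x = 0"
    by (simp add: Basis_quat_def inner_quat_def) (simp add: quat_eq_iff)
  assume "u \<in> Basis" "v \<in> Basis"
  then show "inner u v = (if u = v then 1 else 0)"
    unfolding Basis_quat_def by (elim insertE emptyE) (simp_all add: inner_quat_def)
qed
end

lemma quat_norm_sq: "(norm x)\<^sup>2 = (qRe x)\<^sup>2 + (qI x)\<^sup>2 + (qJ x)\<^sup>2 + (qK x)\<^sup>2" for x :: quat
  by (simp add: norm_quat_def)

definition qcnj :: "quat \<Rightarrow> quat" where
  "qcnj x = Quat (qRe x) (- qI x) (- qJ x) (- qK x)"

instantiation quat :: real_normed_div_algebra
begin
definition "inverse x = qcnj x /\<^sub>R (norm x)\<^sup>2"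
definition "x div y = x * inverse (y :: quat)"
instance
proof
  fix x y :: quat
  show "x div y = x * inverse y" by (rule divide_quat_def)
  show "inverse (0 :: quat) = 0" by (simp add: inverse_quat_def)
  show "norm (x * y) = norm x * norm y"
  proof (rule power2_eq_imp_eq)
    show "(norm (x * y))\<^sup>2 = (norm x * norm y)\<^sup>2"
      by (simp only: power_mult_distrib quat_norm_sq quat_mult_sel) (simp add: power2_eq_square algebra_simps)
  qed simp_all
  assume "x \<noteq> 0"
  then have nz: "(norm x)\<^sup>2 \<noteq> 0" by simp
  have "qcnj x * x = (norm x)\<^sup>2 *\<^sub>R 1" "x * qcnj x = (norm x)\<^sup>2 *\<^sub>R 1"
    by (simp_all only: quat_norm_sq)
      (simp_all add: quat_eq_iff qcnj_def power2_eq_square algebra_simps)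
  with nz show "inverse x * x = 1" "x * inverse x = 1"
    by (simp_all add: inverse_quat_def)
qed
end


section \<open>Words and quaternionic polynomials\<close>

datatype 'n letter = Q 'n | Qbar 'n

fun letter_index :: "'n letter \<Rightarrow> 'n" where
  "letter_index (Q i) = i"
| "letter_index (Qbar i) = i"

fun letter_star :: "'n letter \<Rightarrow> 'n letter" where
  "letter_star (Q i) = Qbar i"
| "letter_star (Qbar i) = Q i"

type_synonym 'n qword = "'n letter list"

definition words_upto :: "nat \<Rightarrow> 'n qword set" where
  "words_upto t = {w. length w \<le> t}"

definition word_star :: "'n qword \<Rightarrow> 'n qword" where
  "word_star w = rev (map letter_star w)"

definition cyclically_equivalent :: "'n qword \<Rightarrow> 'n qword \<Rightarrow> bool" where
  "cyclically_equivalent u v \<longleftrightarrow> (\<exists>w1 w2. u = w1 @ w2 \<and> v = w2 @ w1)"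

text \<open>A pair \<open>(\<alpha>, w)\<close> stands for the product of the \<open>|q_i|^(2 \<alpha>_i)\<close> followed by the word
  \<open>w\<close>; a step moves one factor \<open>q_i qbar_i\<close> or \<open>qbar_i q_i\<close> of \<open>w\<close> to the front.\<close>

inductive norm_step :: "('n \<Rightarrow> nat) \<times> 'n qword \<Rightarrow> ('n \<Rightarrow> nat) \<times> 'n qword \<Rightarrow> bool" where
  "norm_step (\<alpha>, u @ [a, letter_star a] @ v)
     (\<alpha>(letter_index a := Suc (\<alpha> (letter_index a))), u @ v)"

definition has_normal_form :: "'n qword \<Rightarrow> ('n \<Rightarrow> nat) \<times> 'n qword \<Rightarrow> bool" where
  "has_normal_form w f \<longleftrightarrow>
     norm_step\<^sup>*\<^sup>* ((\<lambda>_. 0), w) f \<and> (\<nexists>u a v. snd f = u @ [a, letter_star a] @ v)"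

fun letter_eval :: "quat ^ 'n \<Rightarrow> 'n letter \<Rightarrow> quat" where
  "letter_eval a (Q i) = a $ i"
| "letter_eval a (Qbar i) = qcnj (a $ i)"

definition word_eval :: "quat ^ 'n \<Rightarrow> 'n qword \<Rightarrow> quat" where
  "word_eval a w = prod_list (map (letter_eval a) w)"

text \<open>Elements of the free real algebra are given by their finitely supported coefficients.\<close>

type_synonym 'n qpoly = "'n qword \<Rightarrow>\<^sub>0 real"

definition qpoly_eval :: "quat ^ 'n \<Rightarrow> 'n qpoly \<Rightarrow> quat" where
  "qpoly_eval a p = (\<Sum>w\<in>Poly_Mapping.keys p. of_real (Poly_Mapping.lookup p w) * word_eval a w)"

definition vanishing_ideal :: "'n::finite qpoly set" where
  "vanishing_ideal = {p. \<forall>a :: quat ^ 'n. qpoly_eval a p = 0}"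


section \<open>Pseudo-moment sequences and moment matrices\<close>

text \<open>Sequences are total functions on words; only their values on words of length at most
  \<open>2 * d\<close> matter.\<close>

definition pseudo_moment_sequence :: "nat \<Rightarrow> ('n qword \<Rightarrow> quat) \<Rightarrow> bool" where
  "pseudo_moment_sequence d y \<longleftrightarrow>
     (\<forall>u\<in>words_upto (2 * d). \<forall>v\<in>words_upto (2 * d).
        \<forall>f. has_normal_form u f \<and> has_normal_form v f \<longrightarrow> y u = y v) \<and>
     (\<forall>w\<in>words_upto (2 * d). y w = qcnj (y (word_star w))) \<and>
     (\<forall>u\<in>words_upto (2 * d). \<forall>v\<in>words_upto (2 * d).
        cyclically_equivalent u v \<longrightarrow> qRe (y u) = qRe (y v))"

definition moment_matrix :: "('n qword \<Rightarrow> quat) \<Rightarrow> 'n qword \<Rightarrow> 'n qword \<Rightarrow> quat" where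
  "moment_matrix y u v = y (word_star u @ v)"

text \<open>Matrices are functions of two indices, restricted to a finite index set \<open>I\<close>.
  For a Hermitian matrix the quadratic form is real, so its sign is that of its real part.\<close>

definition quat_psd :: "'i set \<Rightarrow> ('i \<Rightarrow> 'i \<Rightarrow> quat) \<Rightarrow> bool" where
  "quat_psd I M \<longleftrightarrow>
     (\<forall>u\<in>I. \<forall>v\<in>I. M u v = qcnj (M v u)) \<and>
     (\<forall>x. 0 \<le> qRe (\<Sum>u\<in>I. \<Sum>v\<in>I. qcnj (x u) * M u v * x v))"

text \<open>Right column rank: the largest number of columns that are linearly independent over the
  quaternions acting on the right.\<close>

definition quat_rank :: "'i set \<Rightarrow> ('i \<Rightarrow> 'i \<Rightarrow> quat) \<Rightarrow> nat" where
  "quat_rank I M = Max {card B | B. B \<subseteq> I \<and>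
     (\<forall>c. (\<forall>u\<in>I. (\<Sum>v\<in>B. M u v * c v) = 0) \<longrightarrow> (\<forall>v\<in>B. c v = 0))}"


section \<open>The canonical flat representation\<close>

text \<open>\<open>smul x c\<close> is the right scalar multiple of \<open>x\<close> by \<open>c\<close>. Conjugate-linearity of \<open>ip\<close>
  in its first argument follows from \<open>ip_commute\<close>. The spaces used below are
  finite-dimensional, so completeness is automatic.\<close>

locale right_quat_inner_space =
  fixes H :: "'h::ab_group_add set"
    and smul :: "'h \<Rightarrow> quat \<Rightarrow> 'h"
    and ip :: "'h \<Rightarrow> 'h \<Rightarrow> quat"
  assumes zero_closed: "0 \<in> H"
    and add_closed: "x \<in> H \<Longrightarrow> z \<in> H \<Longrightarrow> x + z \<in> H"
    and smul_closed: "x \<in> H \<Longrightarrow> smul x c \<in> H"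
    and smul_add_left: "x \<in> H \<Longrightarrow> z \<in> H \<Longrightarrow> smul (x + z) c = smul x c + smul z c"
    and smul_add_right: "x \<in> H \<Longrightarrow> smul x (c + c') = smul x c + smul x c'"
    and smul_smul: "x \<in> H \<Longrightarrow> smul (smul x c) c' = smul x (c * c')"
    and smul_one: "x \<in> H \<Longrightarrow> smul x 1 = x"
    and ip_commute: "x \<in> H \<Longrightarrow> z \<in> H \<Longrightarrow> ip x z = qcnj (ip z x)"
    and ip_add_right:
      "x \<in> H \<Longrightarrow> z \<in> H \<Longrightarrow> z' \<in> H \<Longrightarrow> ip x (z + z') = ip x z + ip x z'"
    and ip_smul_right: "x \<in> H \<Longrightarrow> z \<in> H \<Longrightarrow> ip x (smul z c) = ip x z * c"
    and ip_nonneg: "x \<in> H \<Longrightarrow> 0 \<le> qRe (ip x x)"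
    and ip_definite: "x \<in> H \<Longrightarrow> ip x x = 0 \<Longrightarrow> x = 0"

definition right_span ::
    "('h::ab_group_add \<Rightarrow> quat \<Rightarrow> 'h) \<Rightarrow> ('i \<Rightarrow> 'h) \<Rightarrow> 'i set \<Rightarrow> 'h set" where
  "right_span smul f I = range (\<lambda>c. \<Sum>i\<in>I. smul (f i) (c i))"

definition right_independent ::
    "('h::ab_group_add \<Rightarrow> quat \<Rightarrow> 'h) \<Rightarrow> ('i \<Rightarrow> 'h) \<Rightarrow> 'i set \<Rightarrow> bool" where
  "right_independent smul f I \<longleftrightarrow>
     (\<forall>c. (\<Sum>i\<in>I. smul (f i) (c i)) = 0 \<longrightarrow> (\<forall>i\<in>I. c i = 0))"

definition has_quat_dim :: "'h::ab_group_add set \<Rightarrow> ('h \<Rightarrow> quat \<Rightarrow> 'h) \<Rightarrow> nat \<Rightarrow> bool" where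
  "has_quat_dim H smul r \<longleftrightarrow>
     (\<exists>b :: nat \<Rightarrow> 'h. (\<forall>i<r. b i \<in> H) \<and>
        right_independent smul b {..<r} \<and> right_span smul b {..<r} = H)"

definition flat_space ::
    "nat \<Rightarrow> nat \<Rightarrow> ('n qword \<Rightarrow> quat) \<Rightarrow> 'h::ab_group_add set \<Rightarrow> ('h \<Rightarrow> quat \<Rightarrow> 'h) \<Rightarrow>
     ('h \<Rightarrow> 'h \<Rightarrow> quat) \<Rightarrow> ('n qword \<Rightarrow> 'h) \<Rightarrow> bool" where
  "flat_space d r y H smul ip v \<longleftrightarrow>
     right_quat_inner_space H smul ip \<and> has_quat_dim H smul r \<and>
     (\<forall>w\<in>words_upto d. v w \<in> H) \<and> right_span smul v (words_upto d) = H \<and>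
     (\<forall>u\<in>words_upto d. \<forall>w\<in>words_upto d. ip (v u) (v w) = y (word_star u @ w))"

definition right_linear_on ::
    "'h::ab_group_add set \<Rightarrow> ('h \<Rightarrow> quat \<Rightarrow> 'h) \<Rightarrow> ('h \<Rightarrow> 'h) \<Rightarrow> bool" where
  "right_linear_on H smul T \<longleftrightarrow>
     (\<forall>x\<in>H. T x \<in> H) \<and> (\<forall>x\<in>H. \<forall>z\<in>H. T (x + z) = T x + T z) \<and>
     (\<forall>x\<in>H. \<forall>c. T (smul x c) = smul (T x) c)"

text \<open>Under flatness such an operator exists and its values on \<open>H\<close> are determined; only these
  are used.\<close>

definition flat_shift ::
    "nat \<Rightarrow> 'h::ab_group_add set \<Rightarrow> ('h \<Rightarrow> quat \<Rightarrow> 'h) \<Rightarrow> ('n qword \<Rightarrow> 'h) \<Rightarrow>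
     'n letter \<Rightarrow> 'h \<Rightarrow> 'h" where
  "flat_shift d H smul v a =
     (SOME T. right_linear_on H smul T \<and> (\<forall>w\<in>words_upto (d - 1). T (v w) = v (a # w)))"

definition flat_word_op ::
    "nat \<Rightarrow> 'h::ab_group_add set \<Rightarrow> ('h \<Rightarrow> quat \<Rightarrow> 'h) \<Rightarrow> ('n qword \<Rightarrow> 'h) \<Rightarrow>
     'n qword \<Rightarrow> 'h \<Rightarrow> 'h" where
  "flat_word_op d H smul v w = foldr (\<lambda>a T. flat_shift d H smul v a \<circ> T) w id"

definition flat_rep ::
    "nat \<Rightarrow> 'h::ab_group_add set \<Rightarrow> ('h \<Rightarrow> quat \<Rightarrow> 'h) \<Rightarrow> ('n qword \<Rightarrow> 'h) \<Rightarrow>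
     'n qpoly \<Rightarrow> 'h \<Rightarrow> 'h" where
  "flat_rep d H smul v p x =
     (\<Sum>w\<in>Poly_Mapping.keys p.
        smul (flat_word_op d H smul v w x) (of_real (Poly_Mapping.lookup p w)))"

definition scalar_consistent ::
    "nat \<Rightarrow> 'h::ab_group_add set \<Rightarrow> ('h \<Rightarrow> quat \<Rightarrow> 'h) \<Rightarrow> ('n::finite qword \<Rightarrow> 'h) \<Rightarrow> bool" where
  "scalar_consistent d H smul v \<longleftrightarrow>
     (\<forall>p\<in>vanishing_ideal. \<forall>x\<in>H. flat_rep d H smul v p x = 0)"


section \<open>Representing measures\<close>

definition atomic_measure ::
    "nat \<Rightarrow> (nat \<Rightarrow> real) \<Rightarrow> (nat \<Rightarrow> quat ^ 'n) \<Rightarrow> (quat ^ 'n::finite) measure" where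
  "atomic_measure N l q =
     measure_of UNIV (sets borel) (\<lambda>A. \<Sum>k<N. ennreal (l k) * emeasure (return borel (q k)) A)"

definition represents :: "nat \<Rightarrow> (quat ^ 'n::finite) measure \<Rightarrow> ('n qword \<Rightarrow> quat) \<Rightarrow> bool" where
  "represents d \<mu> y \<longleftrightarrow>
     (\<forall>w\<in>words_upto (2 * d).
        integrable \<mu> (\<lambda>a. word_eval a w) \<and> y w = (\<integral>a. word_eval a w \<partial>\<mu>))"

end

(* A selfadjoint operator in the image of pi coming from a real-valued polynomial function is central,
   because pi only depends on the underlying function on H^n (scalar consistency). On a minimal invariant
   subspace every such operator is a real scalar, so there the image of pi is a real division algebra
   spanned by 1, by 1, i or by 1, i, j, ij, and correcting a vector x to x - (i x) u_1 and then to
   x - (j x) u_2, with u_1, u_2 the quaternion units acting on the right, produces a joint eigenvector.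
   Its eigenvalues form a point of H^n. Orthogonal complements of joint eigenvectors are invariant, so xi is
   a sum of at most r orthogonal joint eigenvectors; their squared norms are the weights. *)

theory Submission
  imports Defs "HOL-Computational_Algebra.Fundamental_Theorem_Algebra"
begin

section \<open>Right quaternionic inner product spaces\<close>

text \<open>Scalars act on the right, so an eigenvalue is not attached to a line: if X f = f e, then
  X (f c) = (f c) (c^-1 e c). Only real-valued functions give central operators with real
  eigenvalues. The way back to all functions is that F G + G F is real-valued for imaginary F and G,
  hence a scalar on a minimal invariant subspace: imaginary functions act there through Clifford
  relations. An imaginary function orthogonalised against I, J and IJ both commutes and anticommutes
  with IJ, so it acts as 0; this is why three units suffice. Sizes of subspaces are measured by
  lengths of orthogonal families, which needs no theory of bases of subspaces. Flatness enters
  through the words of length at most d - 1: their vectors already span, so each letter acts on the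
  whole space.\<close>

lemma of_real_quat_sel [simp]:
  "qRe (of_real t) = t" "qI (of_real t) = 0" "qJ (of_real t) = 0" "qK (of_real t) = 0"
  by (simp_all add: of_real_def)

lemma quat_of_real_commute: "of_real t * x = x * of_real t" for x :: quat
  by (simp add: quat_eq_iff)

lemma qcnj_sel [simp]:
  "qRe (qcnj x) = qRe x" "qI (qcnj x) = - qI x" "qJ (qcnj x) = - qJ x" "qK (qcnj x) = - qK x"
  by (simp_all add: qcnj_def)

lemma qcnj_simps [simp]:
  "qcnj 0 = 0" "qcnj 1 = 1" "qcnj (x + z) = qcnj x + qcnj z" "qcnj (x - z) = qcnj x - qcnj z"
  "qcnj (- x) = - qcnj x" "qcnj (x * z) = qcnj z * qcnj x" "qcnj (qcnj x) = x"
  "qcnj (of_real t) = of_real t"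
  by (simp_all add: quat_eq_iff)

lemma qcnj_sum: "qcnj (sum f S) = (\<Sum>i\<in>S. qcnj (f i))"
  by (induction S rule: infinite_finite_induct) auto

text \<open>Gaussian elimination, with coefficients on the left and unknowns on the right: the row
  operation subtracts a left multiple of the pivot row. A general division ring is allowed because
  the lemma is applied over the quaternions and over the reals.\<close>

lemma homogeneous_system_nontrivial:
  fixes A :: "'j \<Rightarrow> 'i \<Rightarrow> 'a::division_ring"
  assumes "finite J" "finite I" "card J < card I"
  shows "\<exists>c. (\<exists>i\<in>I. c i \<noteq> 0) \<and> (\<forall>j\<in>J. (\<Sum>i\<in>I. A j i * c i) = 0)"
  using assms
proof (induction J arbitrary: A I rule: finite_induct)
  case empty
  then obtain i where "i \<in> I" by fastforce
  then show ?case by (intro exI[of _ "\<lambda>_. 1"]) auto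
next
  case (insert j J)
  show ?case
  proof (cases "\<forall>i\<in>I. A j i = 0")
    case True
    have "card J < card I" using insert by simp
    from insert.IH[OF \<open>finite I\<close> this, of A] obtain c where
      "\<exists>i\<in>I. c i \<noteq> 0" "\<forall>j\<in>J. (\<Sum>i\<in>I. A j i * c i) = 0" by blast
    with True show ?thesis by (intro exI[of _ c]) auto
  next
    case False
    then obtain k where k: "k \<in> I" "A j k \<noteq> 0" by blast
    define I' where "I' = I - {k}"
    have I: "I = insert k I'" "k \<notin> I'" "finite I'" using k insert.prems by (auto simp: I'_def)
    have cI: "card J < card I'" using insert I by simp
    obtain c where c: "\<exists>i\<in>I'. c i \<noteq> 0"
      "\<And>j'. j' \<in> J \<Longrightarrow> (\<Sum>i\<in>I'. (A j' i - A j' k * inverse (A j k) * A j i) * c i) = 0"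
      using insert.IH[OF \<open>finite I'\<close> cI, of "\<lambda>j' i. A j' i - A j' k * inverse (A j k) * A j i"]
      by blast
    define s where "s = (\<Sum>i\<in>I'. A j i * c i)"
    \<comment> \<open>The pivot unknown is read off from row j once the other unknowns solve the
      reduced system.\<close>
    define c' where "c' = c(k := - inverse (A j k) * s)"
    have sum_c': "(\<Sum>i\<in>I. A j' i * c' i) = A j' k * (- inverse (A j k) * s) + (\<Sum>i\<in>I'. A j' i * c i)" for j'
    proof -
      have "(\<Sum>i\<in>I'. A j' i * c' i) = (\<Sum>i\<in>I'. A j' i * c i)"
        using I(2) by (intro sum.cong) (auto simp: c'_def)
      then show ?thesis using I by (simp add: c'_def)
    qed
    have "(\<Sum>i\<in>I. A j' i * c' i) = 0" if "j' \<in> insert j J" for j'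
    proof (cases "j' = j")
      case True
      then show ?thesis unfolding sum_c' using k(2) by (simp add: s_def mult.assoc[symmetric])
    next
      case False
      with that have "j' \<in> J" by simp
      have "(\<Sum>i\<in>I'. A j' i * c i) - A j' k * inverse (A j k) * s = 0"
        using c(2)[OF \<open>j' \<in> J\<close>]
        by (simp add: s_def left_diff_distrib sum_subtractf sum_distrib_left mult.assoc)
      then show ?thesis unfolding sum_c' by (simp add: mult.assoc)
    qed
    moreover have "\<exists>i\<in>I. c' i \<noteq> 0" using c(1) I by (auto simp: c'_def)
    ultimately show ?thesis by blast
  qed
qed

context right_quat_inner_space
begin

lemma smul_zero_right: "x \<in> H \<Longrightarrow> smul x 0 = 0"
  using smul_add_right[of x 0 0] by simp

lemma smul_minus_right: "x \<in> H \<Longrightarrow> smul x (- c) = - smul x c"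
  using smul_add_right[of x c "- c"] by (simp add: smul_zero_right eq_neg_iff_add_eq_0 add.commute)

lemma minus_closed: "x \<in> H \<Longrightarrow> - x \<in> H"
  using smul_closed[of x "- 1"] by (simp add: smul_minus_right smul_one)

lemma diff_closed: "x \<in> H \<Longrightarrow> z \<in> H \<Longrightarrow> x - z \<in> H"
  using add_closed[of x "- z"] by (simp add: minus_closed)

lemma sum_closed: "(\<And>i. i \<in> I \<Longrightarrow> f i \<in> H) \<Longrightarrow> sum f I \<in> H"
  by (induction I rule: infinite_finite_induct) (auto simp: zero_closed add_closed)

lemmas closed = zero_closed add_closed smul_closed minus_closed diff_closed

lemma smul_zero_left: "smul 0 c = 0"
  using smul_add_left[of 0 0 c] by (simp add: zero_closed)

lemma smul_minus_left: "x \<in> H \<Longrightarrow> smul (- x) c = - smul x c"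
  using smul_add_left[of x "- x" c] by (simp add: minus_closed smul_zero_left eq_neg_iff_add_eq_0 add.commute)

lemma smul_diff_left: "x \<in> H \<Longrightarrow> z \<in> H \<Longrightarrow> smul (x - z) c = smul x c - smul z c"
  using smul_add_left[of x "- z" c] by (simp add: minus_closed smul_minus_left)

lemma smul_sum_left: "(\<And>i. i \<in> I \<Longrightarrow> f i \<in> H) \<Longrightarrow> smul (sum f I) c = (\<Sum>i\<in>I. smul (f i) c)"
  by (induction I rule: infinite_finite_induct) (auto simp: smul_zero_left smul_add_left sum_closed)

lemma smul_sum_right: "x \<in> H \<Longrightarrow> smul x (sum c I) = (\<Sum>i\<in>I. smul x (c i))"
  by (induction I rule: infinite_finite_induct) (auto simp: smul_zero_right smul_add_right)

lemma smul_eq_0_iff: "x \<in> H \<Longrightarrow> smul x c = 0 \<longleftrightarrow> x = 0 \<or> c = 0"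
  by (metis right_inverse smul_one smul_smul smul_zero_left smul_zero_right)

lemma ip_zero_right: "x \<in> H \<Longrightarrow> ip x 0 = 0"
  using ip_add_right[of x 0 0] by (simp add: zero_closed)

lemma ip_minus_right: "x \<in> H \<Longrightarrow> z \<in> H \<Longrightarrow> ip x (- z) = - ip x z"
  using ip_add_right[of x z "- z"] by (simp add: closed ip_zero_right eq_neg_iff_add_eq_0 add.commute)

lemma ip_diff_right: "x \<in> H \<Longrightarrow> z \<in> H \<Longrightarrow> z' \<in> H \<Longrightarrow> ip x (z - z') = ip x z - ip x z'"
  using ip_add_right[of x z "- z'"] by (simp add: closed ip_minus_right)

lemma ip_sum_right: "x \<in> H \<Longrightarrow> (\<And>i. i \<in> I \<Longrightarrow> f i \<in> H) \<Longrightarrow> ip x (sum f I) = (\<Sum>i\<in>I. ip x (f i))"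
  by (induction I rule: infinite_finite_induct) (auto simp: ip_zero_right ip_add_right sum_closed)

lemma ip_add_left: "x \<in> H \<Longrightarrow> z \<in> H \<Longrightarrow> z' \<in> H \<Longrightarrow> ip (x + z) z' = ip x z' + ip z z'"
  by (subst (1 2 3) ip_commute) (simp_all add: closed ip_add_right)

lemma ip_smul_left: "x \<in> H \<Longrightarrow> z \<in> H \<Longrightarrow> ip (smul x c) z = qcnj c * ip x z"
  by (subst (1 2) ip_commute) (simp_all add: closed ip_smul_right)

lemma ip_zero_left: "x \<in> H \<Longrightarrow> ip 0 x = 0"
  by (subst ip_commute) (simp_all add: closed ip_zero_right)

lemma ip_sum_left: "z \<in> H \<Longrightarrow> (\<And>i. i \<in> I \<Longrightarrow> f i \<in> H) \<Longrightarrow> ip (sum f I) z = (\<Sum>i\<in>I. ip (f i) z)"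
  by (induction I rule: infinite_finite_induct) (auto simp: ip_zero_left ip_add_left sum_closed)

lemma ip_self_real: "x \<in> H \<Longrightarrow> ip x x = of_real (qRe (ip x x))"
  using ip_commute[of x x] by (auto simp: quat_eq_iff)

lemma ip_self_pos: "x \<in> H \<Longrightarrow> x \<noteq> 0 \<Longrightarrow> 0 < qRe (ip x x)"
  using ip_nonneg[of x] ip_definite[of x] ip_self_real[of x] by (cases "qRe (ip x x) = 0") auto

lemma ip_orthogonal_sym: "x \<in> H \<Longrightarrow> z \<in> H \<Longrightarrow> ip x z = 0 \<Longrightarrow> ip z x = 0"
  using ip_commute[of z x] by simp

section \<open>Dimension counting\<close>

lemma basis_coordinates:
  assumes "has_quat_dim H smul r"
  obtains b where "\<And>i. i < r \<Longrightarrow> b i \<in> H" "\<And>x. x \<in> H \<Longrightarrow> \<exists>c. x = (\<Sum>i<r. smul (b i) (c i))"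
proof -
  from assms obtain b where b: "\<forall>i<r. b i \<in> H" "right_span smul b {..<r} = H"
    unfolding has_quat_dim_def by (elim exE conjE)
  have "\<exists>c. x = (\<Sum>i<r. smul (b i) (c i))" if "x \<in> H" for x
  proof -
    have "x \<in> right_span smul b {..<r}" using that b(2) by simp
    then show ?thesis by (auto simp: right_span_def)
  qed
  with b(1) that show ?thesis by blast
qed

text \<open>Coordinates end up to the left of the coefficients, which is the shape of
  \<open>homogeneous_system_nontrivial\<close>.\<close>

lemma combination_in_coordinates:
  assumes "\<And>k. k < r \<Longrightarrow> b k \<in> H" "\<And>i. i \<in> I \<Longrightarrow> g i = (\<Sum>k<r. smul (b k) (C k i))"
  shows "(\<Sum>i\<in>I. smul (g i) (c i)) = (\<Sum>k<r. smul (b k) (\<Sum>i\<in>I. C k i * c i))"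
proof -
  have "smul (g i) (c i) = (\<Sum>k<r. smul (b k) (C k i * c i))" if "i \<in> I" for i
  proof -
    have "smul (g i) (c i) = (\<Sum>k<r. smul (smul (b k) (C k i)) (c i))"
      unfolding assms(2)[OF that] using assms(1) by (intro smul_sum_left smul_closed) simp
    also have "\<dots> = (\<Sum>k<r. smul (b k) (C k i * c i))"
      using assms(1) by (intro sum.cong refl smul_smul) simp
    finally show ?thesis .
  qed
  then have "(\<Sum>i\<in>I. smul (g i) (c i)) = (\<Sum>i\<in>I. \<Sum>k<r. smul (b k) (C k i * c i))"
    by (intro sum.cong) simp_all
  also have "\<dots> = (\<Sum>k<r. \<Sum>i\<in>I. smul (b k) (C k i * c i))" by (rule sum.swap)
  also have "\<dots> = (\<Sum>k<r. smul (b k) (\<Sum>i\<in>I. C k i * c i))"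
    using assms(1) by (intro sum.cong refl smul_sum_right[symmetric]) simp
  finally show ?thesis .
qed

lemma too_many_dependent:
  assumes dim: "has_quat_dim H smul r" and "finite I" "r < card I" "\<And>i. i \<in> I \<Longrightarrow> g i \<in> H"
  shows "\<exists>c. (\<exists>i\<in>I. c i \<noteq> 0) \<and> (\<Sum>i\<in>I. smul (g i) (c i)) = 0"
proof -
  obtain b where b: "\<And>i. i < r \<Longrightarrow> b i \<in> H" "\<And>x. x \<in> H \<Longrightarrow> \<exists>c. x = (\<Sum>i<r. smul (b i) (c i))"
    using basis_coordinates[OF dim] by blast
  have "\<forall>i\<in>I. \<exists>c. g i = (\<Sum>k<r. smul (b k) (c k))" using assms b by blast
  then obtain C where C: "\<And>i. i \<in> I \<Longrightarrow> g i = (\<Sum>k<r. smul (b k) (C i k))" by metis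
  obtain c where c: "\<exists>i\<in>I. c i \<noteq> 0" "\<forall>k\<in>{..<r}. (\<Sum>i\<in>I. C i k * c i) = 0"
    using homogeneous_system_nontrivial[of "{..<r}" I "\<lambda>k i. C i k"] assms by auto
  have "(\<Sum>i\<in>I. smul (g i) (c i)) = (\<Sum>k<r. smul (b k) (\<Sum>i\<in>I. C i k * c i))"
    using b(1) C by (rule combination_in_coordinates)
  also have "\<dots> = 0" using c(2) b(1) by (simp add: smul_zero_right)
  finally show ?thesis using c(1) by blast
qed

text \<open>Each quaternionic coordinate amounts to four real equations, hence the bound 4 r. Real
  coefficients matter because only real polynomials in a function stay inside the algebra.\<close>

lemma too_many_dependent_real:
  assumes dim: "has_quat_dim H smul r" and "finite I" "4 * r < card I" "\<And>i. i \<in> I \<Longrightarrow> g i \<in> H"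
  shows "\<exists>c. (\<exists>i\<in>I. c i \<noteq> 0) \<and> (\<Sum>i\<in>I. smul (g i) (of_real (c i))) = 0"
proof -
  obtain b where b: "\<And>i. i < r \<Longrightarrow> b i \<in> H" "\<And>x. x \<in> H \<Longrightarrow> \<exists>c. x = (\<Sum>i<r. smul (b i) (c i))"
    using basis_coordinates[OF dim] by blast
  have "\<forall>i\<in>I. \<exists>c. g i = (\<Sum>k<r. smul (b k) (c k))" using assms b by blast
  then obtain C where C: "\<And>i. i \<in> I \<Longrightarrow> g i = (\<Sum>k<r. smul (b k) (C i k))" by metis
  have "card (Basis :: quat set) = 4"
    by (simp add: Basis_quat_def)
  then obtain c where c: "\<exists>i\<in>I. c i \<noteq> 0"
     "\<forall>p\<in>{..<r} \<times> (Basis :: quat set). (\<Sum>i\<in>I. inner (C i (fst p)) (snd p) * c i) = 0"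
    using homogeneous_system_nontrivial[of "{..<r} \<times> (Basis :: quat set)" I
        "\<lambda>p i. inner (C i (fst p)) (snd p)"] assms
    by (auto simp: card_cartesian_product mult.commute)
  have zero: "(\<Sum>i\<in>I. C i k * of_real (c i)) = 0" if "k < r" for k
  proof (rule euclidean_eqI)
    fix e :: quat assume "e \<in> Basis"
    then have "(\<Sum>i\<in>I. inner (C i k) e * c i) = 0" using c(2) that by force
    moreover have "inner (C i k * of_real (c i)) e = inner (C i k) e * c i" for i
      by (simp add: inner_quat_def algebra_simps)
    ultimately show "inner (\<Sum>i\<in>I. C i k * of_real (c i)) e = inner 0 e"
      by (simp add: inner_sum_left)
  qed
  have "(\<Sum>i\<in>I. smul (g i) (of_real (c i))) = (\<Sum>k<r. smul (b k) (\<Sum>i\<in>I. C i k * of_real (c i)))"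
    using b(1) C by (rule combination_in_coordinates)
  also have "\<dots> = 0" using zero b(1) by (simp add: smul_zero_right)
  finally show ?thesis using c(1) by blast
qed

text \<open>Adding x to r independent vectors gives r + 1 vectors, hence a relation; independence
  forces the coefficient of x in it to be nonzero, so it can be solved for x.\<close>

lemma independent_spans:
  assumes dim: "has_quat_dim H smul r" and "finite B" "card B = r" "\<And>i. i \<in> B \<Longrightarrow> g i \<in> H"
    and ind: "right_independent smul g B" and x: "x \<in> H"
  shows "\<exists>c. x = (\<Sum>i\<in>B. smul (g i) (c i))"
proof -
  \<comment> \<open>The index \<open>None\<close> belongs to x and cannot collide with an index from
    B.\<close>
  define I where "I = insert None (Some ` B)"
  define g' where "g' = case_option x g"
  have "card I = Suc r" using assms by (simp add: I_def card_image)
  moreover have "finite I" "\<And>i. i \<in> I \<Longrightarrow> g' i \<in> H"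
    using assms by (auto simp: I_def g'_def)
  ultimately obtain c where c: "\<exists>i\<in>I. c i \<noteq> 0" "(\<Sum>i\<in>I. smul (g' i) (c i)) = 0"
    using too_many_dependent[OF dim, of I g'] by (metis lessI)
  have "(\<Sum>i\<in>I. smul (g' i) (c i)) = smul x (c None) + (\<Sum>i\<in>B. smul (g i) (c (Some i)))"
    using assms by (simp add: I_def g'_def sum.reindex)
  with c(2) have sum0: "smul x (c None) + (\<Sum>i\<in>B. smul (g i) (c (Some i))) = 0" by simp
  have nz: "c None \<noteq> 0"
  proof
    assume "c None = 0"
    with sum0 x have "(\<Sum>i\<in>B. smul (g i) (c (Some i))) = 0" by (simp add: smul_zero_right)
    with ind have "\<forall>i\<in>B. c (Some i) = 0" by (auto simp: right_independent_def)
    with \<open>c None = 0\<close> c(1) show False by (auto simp: I_def)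
  qed
  have "x = smul (smul x (c None)) (inverse (c None))"
    using nz x by (simp add: smul_smul smul_one)
  also have "smul x (c None) = - (\<Sum>i\<in>B. smul (g i) (c (Some i)))"
    using sum0 by (simp add: eq_neg_iff_add_eq_0)
  also have "\<dots> = (\<Sum>i\<in>B. smul (g i) (- c (Some i)))"
    using assms by (simp add: smul_minus_right sum_negf)
  also have "smul \<dots> (inverse (c None)) = (\<Sum>i\<in>B. smul (g i) (- c (Some i) * inverse (c None)))"
    using assms by (simp add: smul_sum_left smul_smul smul_closed)
  finally show ?thesis by (intro exI[of _ "\<lambda>i. - c (Some i) * inverse (c None)"])
qed

text \<open>S may be any set: it is an invariant subspace in one use and the set of joint
  eigenvectors, which is not a subspace, in another. The vectors are not normalised, since their
  squared norms become the weights.\<close>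

definition orthogonal_family :: "'h set \<Rightarrow> nat \<Rightarrow> (nat \<Rightarrow> 'h) \<Rightarrow> bool" where
  "orthogonal_family S n f \<longleftrightarrow>
     (\<forall>i<n. f i \<in> S \<and> f i \<noteq> 0) \<and> (\<forall>i<n. \<forall>j<n. i \<noteq> j \<longrightarrow> ip (f i) (f j) = 0)"

lemma ip_orthogonal_combination:
  assumes "S \<subseteq> H" "orthogonal_family S n f" "i < n"
  shows "ip (f i) (\<Sum>j<n. smul (f j) (c j)) = ip (f i) (f i) * c i"
proof -
  have H: "f j \<in> H" if "j < n" for j using assms that by (auto simp: orthogonal_family_def)
  have "ip (f i) (\<Sum>j<n. smul (f j) (c j)) = (\<Sum>j<n. ip (f i) (smul (f j) (c j)))"
    using H assms(3) by (intro ip_sum_right smul_closed) simp_all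
  also have "\<dots> = (\<Sum>j<n. ip (f i) (f j) * c j)"
    using H assms(3) by (intro sum.cong) (simp_all add: ip_smul_right)
  also have "\<dots> = (\<Sum>j<n. if j = i then ip (f i) (f i) * c i else 0)"
    using assms by (intro sum.cong) (auto simp: orthogonal_family_def)
  finally show ?thesis using assms by simp
qed

lemma orthogonal_family_le:
  assumes dim: "has_quat_dim H smul r" and "S \<subseteq> H" "orthogonal_family S n f"
  shows "n \<le> r"
proof (rule ccontr)
  assume "\<not> n \<le> r"
  have H: "f j \<in> H" "f j \<noteq> 0" if "j < n" for j using assms that by (auto simp: orthogonal_family_def)
  have "\<exists>c. (\<exists>i\<in>{..<n}. c i \<noteq> 0) \<and> (\<Sum>i<n. smul (f i) (c i)) = 0"
    using H \<open>\<not> n \<le> r\<close> by (intro too_many_dependent[OF dim]) simp_all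
  then obtain c i where c: "i < n" "c i \<noteq> 0" "(\<Sum>i<n. smul (f i) (c i)) = 0" by blast
  have "ip (f i) (f i) * c i = 0"
    using ip_orthogonal_combination[OF assms(2,3) c(1), of c] c(3) H(1)[OF c(1)] by (simp add: ip_zero_right)
  with c(2) H[OF c(1)] show False using ip_definite by auto
qed

text \<open>Gram-Schmidt without normalisation: the right coefficient of f j is the inverse of <f j,
  f j> times <f j, x>, in this order.\<close>

lemma orthogonal_residual:
  assumes "S \<subseteq> H" "orthogonal_family S n f" "x \<in> H"
  shows "\<exists>c. \<forall>i<n. ip (f i) (x - (\<Sum>j<n. smul (f j) (c j))) = 0"
proof -
  have H: "f j \<in> H" "f j \<noteq> 0" if "j < n" for j using assms that by (auto simp: orthogonal_family_def)
  have "ip (f i) (x - (\<Sum>j<n. smul (f j) (inverse (ip (f j) (f j)) * ip (f j) x))) = 0" if "i < n" for i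
  proof -
    have "ip (f i) (f i) \<noteq> 0" using H[OF that] ip_definite by blast
    moreover have "(\<Sum>j<n. smul (f j) (inverse (ip (f j) (f j)) * ip (f j) x)) \<in> H"
      using H by (intro sum_closed smul_closed) simp
    ultimately show ?thesis
      using ip_orthogonal_combination[OF assms(1,2) that, of "\<lambda>j. inverse (ip (f j) (f j)) * ip (f j) x"]
        H that assms(3) by (simp add: ip_diff_right mult.assoc[symmetric])
  qed
  then show ?thesis by (intro exI[of _ "\<lambda>j. inverse (ip (f j) (f j)) * ip (f j) x"]) blast
qed

lemma orthogonal_family_extend:
  assumes "S \<subseteq> H" "orthogonal_family S n f" "x \<in> S" "x \<noteq> 0" "\<And>i. i < n \<Longrightarrow> ip (f i) x = 0"
  shows "orthogonal_family S (Suc n) (f(n := x))"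
proof -
  have H: "f j \<in> H" "f j \<in> S" "f j \<noteq> 0" if "j < n" for j using assms that by (auto simp: orthogonal_family_def)
  have "ip x (f j) = 0" if "j < n" for j
    using assms H that by (auto intro: ip_orthogonal_sym[of "f j" x])
  with H assms show ?thesis
    unfolding orthogonal_family_def by (auto simp: less_Suc_eq)
qed

lemma maximal_orthogonal_family:
  assumes dim: "has_quat_dim H smul r" and "S \<subseteq> H"
  obtains n f where "orthogonal_family S n f" "\<And>m g. orthogonal_family S m g \<Longrightarrow> m \<le> n"
proof -
  have "\<exists>n. (\<exists>f. orthogonal_family S n f) \<and> (\<forall>m. (\<exists>f. orthogonal_family S m f) \<longrightarrow> m \<le> n)"
  proof (rule Nat.ex_has_greatest_nat)
    show "\<exists>f. orthogonal_family S 0 f" by (simp add: orthogonal_family_def)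
    show "\<forall>m. (\<exists>f. orthogonal_family S m f) \<longrightarrow> m \<le> r"
      using orthogonal_family_le[OF assms] by blast
  qed
  then show ?thesis using that by blast
qed

end


section \<open>Real-valued functions act as scalars on minimal invariant subspaces\<close>

lemma poly_map_poly_of_real_add:
  "poly (map_poly of_real (p + q)) w =
     (poly (map_poly of_real p) w + poly (map_poly of_real q) w :: complex)"
proof -
  have "map_poly complex_of_real (p + q) = map_poly of_real p + map_poly of_real q"
    by (intro poly_eqI) (simp add: coeff_map_poly)
  then show ?thesis by simp
qed

lemma poly_map_poly_of_real_mult:
  "poly (map_poly of_real (p * q)) w =
     (poly (map_poly of_real p) w * poly (map_poly of_real q) w :: complex)"
proof (induction p)
  case (pCons c p)
  have "poly (map_poly of_real (smult c q)) w = of_real c * (poly (map_poly of_real q) w :: complex)"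
    by (simp add: map_poly_smult)
  with pCons show ?case
    by (simp add: poly_map_poly_of_real_add map_poly_pCons algebra_simps)
qed simp

text \<open>A complex root w = a + b i with b nonzero is matched by the real quadratic with roots w
  and its conjugate. The quadratic is recorded through a and b because (X - a)^2 + b^2 is the form
  that contradicts selfadjointness.\<close>

lemma real_poly_has_factor:
  fixes p :: "real poly"
  assumes "degree p \<noteq> 0"
  obtains t g where "p = [:- t, 1:] * g"
    | a b g where "b \<noteq> 0" "p = [:a\<^sup>2 + b\<^sup>2, - 2 * a, 1:] * g"
proof -
  have "degree (map_poly complex_of_real p) = degree p"
    using assms by (intro map_poly_degree_eq) auto
  then have "\<not> constant (poly (map_poly complex_of_real p))"
    using assms by (simp add: constant_degree)
  then obtain w where w: "poly (map_poly complex_of_real p) w = 0"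
    using fundamental_theorem_of_algebra by blast
  show thesis
  proof (cases "Im w = 0")
    case True
    have "complex_of_real (poly p (Re w)) = poly (map_poly complex_of_real p) (of_real (Re w))"
      by (induction p) (simp_all add: map_poly_pCons)
    moreover have "complex_of_real (Re w) = w" using True by (simp add: complex_eq_iff)
    ultimately have "poly p (Re w) = 0" using w by simp
    then show thesis using that(1) by (metis dvdE poly_eq_0_iff_dvd)
  next
    case False
    let ?a = "Re w" and ?b = "Im w"
    define q where "q = [:?a\<^sup>2 + ?b\<^sup>2, - 2 * ?a, 1:]"
    have dq: "degree q = 2" "q \<noteq> 0" by (simp_all add: q_def)
    have qw: "poly (map_poly complex_of_real q) w = 0"
      by (simp add: q_def complex_eq_iff map_poly_pCons power2_eq_square algebra_simps)
    \<comment> \<open>A real polynomial of degree below 2 that vanishes at a nonreal number has zero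
      coefficients, so this remainder is 0.\<close>
    define s where "s = p mod q"
    have ds: "s = 0 \<or> degree s < 2" using degree_mod_less[of q p] dq by (auto simp: s_def)
    have p: "p = p div q * q + s" by (simp add: s_def)
    have "poly (map_poly complex_of_real s) w = 0"
      using w qw by (subst (asm) p) (simp add: poly_map_poly_of_real_add poly_map_poly_of_real_mult)
    moreover have s: "s = [:coeff s 0, coeff s 1:]"
      using ds by (intro poly_eqI) (auto simp: coeff_pCons coeff_eq_0 split: nat.split)
    ultimately have "poly (map_poly complex_of_real [:coeff s 0, coeff s 1:]) w = 0" by simp
    then have "coeff s 1 = 0" "coeff s 0 = 0" using False by (auto simp: complex_eq_iff map_poly_pCons)
    then have "s = 0" using s by simp
    then show thesis using p False that(2)[of ?b ?a "p div q"] by (simp add: q_def mult.commute)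
  qed
qed

text \<open>The abstract form of a representation that depends only on polynomial functions: \<open>'p\<close> is a set of
  points and \<open>A\<close> a real *-algebra of quaternion-valued functions on it.\<close>

locale quat_function_rep = right_quat_inner_space H smul ip
  for H :: "'h::ab_group_add set" and smul :: "'h \<Rightarrow> quat \<Rightarrow> 'h" and ip :: "'h \<Rightarrow> 'h \<Rightarrow> quat" +
  fixes A :: "('p \<Rightarrow> quat) set" and op :: "('p \<Rightarrow> quat) \<Rightarrow> 'h \<Rightarrow> 'h" and r :: nat
  assumes dim: "has_quat_dim H smul r"
    and const_mem: "(\<lambda>_. of_real t) \<in> A"
    and add_mem: "F \<in> A \<Longrightarrow> G \<in> A \<Longrightarrow> (\<lambda>a. F a + G a) \<in> A"
    and mult_mem: "F \<in> A \<Longrightarrow> G \<in> A \<Longrightarrow> (\<lambda>a. F a * G a) \<in> A"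
    and cnj_mem: "F \<in> A \<Longrightarrow> (\<lambda>a. qcnj (F a)) \<in> A"
    and op_closed: "F \<in> A \<Longrightarrow> x \<in> H \<Longrightarrow> op F x \<in> H"
    and op_add: "F \<in> A \<Longrightarrow> x \<in> H \<Longrightarrow> z \<in> H \<Longrightarrow> op F (x + z) = op F x + op F z"
    and op_smul: "F \<in> A \<Longrightarrow> x \<in> H \<Longrightarrow> op F (smul x c) = smul (op F x) c"
    and op_const: "x \<in> H \<Longrightarrow> op (\<lambda>_. of_real t) x = smul x (of_real t)"
    and op_fun_add: "F \<in> A \<Longrightarrow> G \<in> A \<Longrightarrow> x \<in> H \<Longrightarrow> op (\<lambda>a. F a + G a) x = op F x + op G x"
    and op_fun_mult: "F \<in> A \<Longrightarrow> G \<in> A \<Longrightarrow> x \<in> H \<Longrightarrow> op (\<lambda>a. F a * G a) x = op F (op G x)"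
    and op_adjoint: "F \<in> A \<Longrightarrow> x \<in> H \<Longrightarrow> z \<in> H \<Longrightarrow> ip (op F x) z = ip x (op (\<lambda>a. qcnj (F a)) z)"
begin

lemma scale_mem: "F \<in> A \<Longrightarrow> (\<lambda>a. of_real t * F a) \<in> A"
  by (rule mult_mem[OF const_mem])

lemma op_fun_scale: "F \<in> A \<Longrightarrow> x \<in> H \<Longrightarrow> op (\<lambda>a. of_real t * F a) x = smul (op F x) (of_real t)"
  using op_fun_mult[OF const_mem, of F x t] by (simp add: op_const op_closed)

lemma diff_mem: "F \<in> A \<Longrightarrow> G \<in> A \<Longrightarrow> (\<lambda>a. F a - G a) \<in> A"
  using add_mem[OF _ scale_mem, of F G "- 1"] by simp

lemma op_fun_diff: "F \<in> A \<Longrightarrow> G \<in> A \<Longrightarrow> x \<in> H \<Longrightarrow> op (\<lambda>a. F a - G a) x = op F x - op G x"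
  using op_fun_add[OF _ scale_mem, of F G x "- 1"] op_fun_scale[of G x "- 1"]
  by (simp add: smul_minus_right smul_one op_closed)

lemma op_zero: "F \<in> A \<Longrightarrow> op F 0 = 0"
  using op_add[of F 0 0] by (simp add: zero_closed)

lemma op_minus: "F \<in> A \<Longrightarrow> x \<in> H \<Longrightarrow> op F (- x) = - op F x"
  using op_add[of F x "- x"] by (simp add: closed op_zero eq_neg_iff_add_eq_0 add.commute)

lemma op_diff: "F \<in> A \<Longrightarrow> x \<in> H \<Longrightarrow> z \<in> H \<Longrightarrow> op F (x - z) = op F x - op F z"
  using op_add[of F x "- z"] by (simp add: closed op_minus)

lemma fun_sum_mem_op:
  assumes "finite I" "\<And>i. i \<in> I \<Longrightarrow> F i \<in> A" "x \<in> H"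
  shows "(\<lambda>a. \<Sum>i\<in>I. F i a) \<in> A \<and> op (\<lambda>a. \<Sum>i\<in>I. F i a) x = (\<Sum>i\<in>I. op (F i) x)"
  using assms
proof (induction I rule: finite_induct)
  case empty
  then show ?case using const_mem[of 0] op_const[of x 0] by (simp add: smul_zero_right)
next
  case (insert i I)
  then show ?case
    using add_mem[of "F i" "\<lambda>a. \<Sum>i\<in>I. F i a"] op_fun_add[of "F i" "\<lambda>a. \<Sum>i\<in>I. F i a" x] by simp
qed

lemma op_real_commute:
  assumes "(\<lambda>a. of_real (h a)) \<in> A" "G \<in> A" "x \<in> H"
  shows "op (\<lambda>a. of_real (h a)) (op G x) = op G (op (\<lambda>a. of_real (h a)) x)"
  using op_fun_mult[OF assms] op_fun_mult[OF assms(2,1,3)] by (simp add: quat_of_real_commute)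

lemma poly_mem:
  assumes "(\<lambda>a. of_real (h a)) \<in> A"
  shows "(\<lambda>a. of_real (poly p (h a))) \<in> A"
proof (induction p)
  case 0
  show ?case using const_mem[of 0] by simp
next
  case (pCons c p)
  then show ?case using add_mem[OF const_mem mult_mem[OF assms pCons.IH], of c] by simp
qed

section \<open>Invariant subspaces and eigenvectors of real-valued functions\<close>

definition invariant :: "'h set \<Rightarrow> bool" where
  "invariant K \<longleftrightarrow> K \<subseteq> H \<and> 0 \<in> K \<and> (\<forall>x\<in>K. \<forall>z\<in>K. x + z \<in> K) \<and> (\<forall>x\<in>K. \<forall>c. smul x c \<in> K) \<and>
     (\<forall>F\<in>A. \<forall>x\<in>K. op F x \<in> K)"

lemma invariant_sum: "invariant K \<Longrightarrow> (\<And>i. i \<in> I \<Longrightarrow> g i \<in> K) \<Longrightarrow> sum g I \<in> K"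
  by (induction I rule: infinite_finite_induct) (auto simp: invariant_def)

lemma invariant_minus: "invariant K \<Longrightarrow> x \<in> K \<Longrightarrow> - x \<in> K"
  using smul_minus_right[of x 1] smul_one[of x] unfolding invariant_def by (metis subsetD)

lemma invariant_diff: "invariant K \<Longrightarrow> x \<in> K \<Longrightarrow> z \<in> K \<Longrightarrow> x - z \<in> K"
  using invariant_minus[of K z] unfolding invariant_def by (metis add_uminus_conv_diff)

text \<open>The 4 r + 1 vectors obtained by applying the powers of h with exponents 0, ..., 4 r to x
  are dependent over the reals.\<close>

lemma annihilating_poly:
  assumes h: "(\<lambda>a. of_real (h a)) \<in> A" and x: "x \<in> H"
  shows "\<exists>p. p \<noteq> 0 \<and> op (\<lambda>a. of_real (poly p (h a))) x = 0"
proof -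
  let ?g = "\<lambda>k. op (\<lambda>a. of_real (poly (monom 1 k) (h a))) x"
  have "\<exists>c. (\<exists>k\<in>{..4 * r}. c k \<noteq> 0) \<and> (\<Sum>k\<le>4 * r. smul (?g k) (of_real (c k))) = 0"
    by (rule too_many_dependent_real[OF dim]) (auto intro: op_closed poly_mem h x)
  then obtain c k where c: "k \<le> 4 * r" "c k \<noteq> 0" "(\<Sum>k\<le>4 * r. smul (?g k) (of_real (c k))) = 0"
    by blast
  define p where "p = (\<Sum>k\<le>4 * r. monom (c k) k)"
  have "coeff p k = c k" using c(1) by (simp add: p_def coeff_sum)
  then have "p \<noteq> 0" using c(2) by auto
  have "(\<lambda>a. of_real (poly p (h a))) =
      (\<lambda>a. \<Sum>k\<le>4 * r. of_real (c k) * of_real (poly (monom 1 k) (h a)) :: quat)"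
    by (simp add: p_def poly_sum poly_monom)
  then have "op (\<lambda>a. of_real (poly p (h a))) x =
      (\<Sum>k\<le>4 * r. op (\<lambda>a. of_real (c k) * of_real (poly (monom 1 k) (h a))) x)"
    using fun_sum_mem_op[of "{..4 * r}" "\<lambda>k a. of_real (c k) * of_real (poly (monom 1 k) (h a))" x]
      scale_mem[OF poly_mem[OF h]] x by simp
  also have "\<dots> = (\<Sum>k\<le>4 * r. smul (?g k) (of_real (c k)))"
    by (intro sum.cong refl op_fun_scale poly_mem h x)
  finally show ?thesis using c(3) \<open>p \<noteq> 0\<close> by auto
qed

text \<open>A substitute for the spectral theorem. A real factor of an annihilating polynomial kills
  a nonzero vector of K: a linear factor yields the eigenvector, and a quadratic one is impossible
  because a real-valued function acts as a selfadjoint operator.\<close>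

lemma real_op_eigenvector:
  assumes h: "(\<lambda>a. of_real (h a)) \<in> A" and K: "invariant K" and x: "x \<in> K" "x \<noteq> 0"
  shows "\<exists>z t. z \<in> K \<and> z \<noteq> 0 \<and> op (\<lambda>a. of_real (h a)) z = smul z (of_real t)"
proof -
  have KH: "z \<in> H" if "z \<in> K" for z using K that by (auto simp: invariant_def)
  have opK: "op F z \<in> K" if "F \<in> A" "z \<in> K" for F z using K that by (auto simp: invariant_def)
  (* A pair (p, z) with p of minimal degree: for any proper factor g of p, g(h) z is again nonzero. *)
  define P where "P = (\<lambda>(p, z). z \<in> K \<and> z \<noteq> 0 \<and> p \<noteq> 0 \<and> op (\<lambda>a. of_real (poly p (h a))) z = 0)"
  obtain p0 where "P (p0, x)"
    using annihilating_poly[OF h KH[OF x(1)]] x by (auto simp: P_def)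
  then obtain p z where Pp: "P (p, z)" and min: "\<And>q z'. P (q, z') \<Longrightarrow> degree p \<le> degree q"
    using ex_has_least_nat[of P "(p0, x)" "degree \<circ> fst"] by auto
  then have z: "z \<in> K" "z \<noteq> 0" and p: "p \<noteq> 0" "op (\<lambda>a. of_real (poly p (h a))) z = 0"
    by (auto simp: P_def)
  note mem = poly_mem[OF h]
  have factor: "\<exists>z'\<in>K. z' \<noteq> 0 \<and> op (\<lambda>a. of_real (poly q (h a))) z' = 0"
    if "p = q * g" "degree q > 0" for q g
  proof (intro bexI conjI)
    let ?z = "op (\<lambda>a. of_real (poly g (h a))) z"
    show "?z \<in> K" by (rule opK[OF mem z(1)])
    have "degree g < degree p" using that p(1) by (auto simp: degree_mult_eq)
    then show "?z \<noteq> 0"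
      using min[of g z] z p(1) that by (auto simp: P_def)
    have "(\<lambda>a. of_real (poly p (h a))) = (\<lambda>a. of_real (poly q (h a)) * of_real (poly g (h a)) :: quat)"
      by (simp add: that)
    then show "op (\<lambda>a. of_real (poly q (h a))) ?z = 0"
      using op_fun_mult[OF mem[of q] mem[of g] KH[OF z(1)]] p(2) by simp
  qed
  \<comment> \<open>A nonzero real constant acts injectively and cannot annihilate z.\<close>
  have "degree p \<noteq> 0"
  proof
    assume "degree p = 0"
    then obtain c where "p = [:c:]" by (metis degree_eq_zeroE)
    then show False using p z KH op_const[of z c] by (auto simp: smul_eq_0_iff)
  qed
  then show ?thesis
  proof (cases rule: real_poly_has_factor)
    case (1 t g)
    then obtain z' where z': "z' \<in> K" "z' \<noteq> 0" "op (\<lambda>a. of_real (poly [:- t, 1:] (h a))) z' = 0"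
      using factor[of "[:- t, 1:]" g] by auto
    have "op (\<lambda>a. of_real (h a)) z' - smul z' (of_real t) = 0"
      using z' op_fun_diff[OF h const_mem, of z' t] KH[OF z'(1)] by (simp add: op_const)
    then show ?thesis using z' by auto
  next
    case (2 a b g)
    define q where "q = [:a\<^sup>2 + b\<^sup>2, - 2 * a, 1:]"
    have "\<exists>z'\<in>K. z' \<noteq> 0 \<and> op (\<lambda>a. of_real (poly q (h a))) z' = 0"
    proof (rule factor)
      show "p = q * g" using 2(2) by (simp only: q_def)
    qed (simp add: q_def)
    then obtain z' where z': "z' \<in> K" "z' \<noteq> 0" "op (\<lambda>a. of_real (poly q (h a))) z' = 0"
      by blast
    let ?u = "\<lambda>e. of_real (h e - a) :: quat"
    have u: "?u \<in> A" using diff_mem[OF h const_mem] by simp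
    note z'H = KH[OF z'(1)]
    \<comment> \<open>With U the operator of h - a, completing the square gives U (U z') + b^2 z' =
      0. Pairing with z' yields |U z'|^2 + b^2 |z'|^2 = 0, against b and z' nonzero.\<close>
    have "poly q (h e) = (h e - a) * (h e - a) + b\<^sup>2" for e
      by (simp add: q_def power2_eq_square algebra_simps)
    then have "(\<lambda>e. of_real (poly q (h e))) = (\<lambda>e. ?u e * ?u e + of_real (b\<^sup>2) :: quat)"
      by (simp only: of_real_add of_real_mult)
    then have "op ?u (op ?u z') + smul z' (of_real (b\<^sup>2)) = 0"
      using op_fun_add[OF mult_mem[OF u u] const_mem z'H, of "b\<^sup>2"] op_fun_mult[OF u u z'H] z'(3)
        op_const[OF z'H, of "b\<^sup>2"] by simp
    then have "ip z' (op ?u (op ?u z') + smul z' (of_real (b\<^sup>2))) = 0"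
      using z'H by (simp add: ip_zero_right)
    then have "ip z' (op ?u (op ?u z')) + ip z' z' * of_real (b\<^sup>2) = 0"
      using z'H u by (simp add: ip_add_right ip_smul_right closed op_closed)
    moreover have "ip z' (op ?u (op ?u z')) = ip (op ?u z') (op ?u z')"
      using op_adjoint[OF u z'H op_closed[OF u z'H]] by simp
    ultimately have "qRe (ip (op ?u z') (op ?u z')) + qRe (ip z' z') * b\<^sup>2 = 0"
      by (metis (no_types, lifting) mult_zero_right diff_zero of_real_quat_sel quat_add_sel(1,5) quat_mult_sel(5))
    moreover have "qRe (ip (op ?u z') (op ?u z')) \<ge> 0" using ip_nonneg op_closed[OF u z'H] by blast
    moreover have "qRe (ip z' z') * b\<^sup>2 > 0" using ip_self_pos[OF z'H z'(2)] 2(1) by simp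
    ultimately show ?thesis by linarith
  qed
qed

definition minimal_invariant :: "'h set \<Rightarrow> bool" where
  "minimal_invariant K \<longleftrightarrow> invariant K \<and> K \<noteq> {0} \<and>
     (\<forall>K'. invariant K' \<and> K' \<subseteq> K \<and> K' \<noteq> {0} \<longrightarrow> K' = K)"

lemma invariant_nonzero: "invariant K \<Longrightarrow> K \<noteq> {0} \<Longrightarrow> \<exists>x\<in>K. x \<noteq> 0"
  unfolding invariant_def by blast

lemma minimal_invariant_exists:
  assumes K: "invariant K" "K \<noteq> {0}"
  shows "\<exists>M. minimal_invariant M \<and> M \<subseteq> K"
proof -
  (* The least n bounding all orthogonal families of some M plays the role of the dimension of M. *)
  define bounds where
    "bounds = (\<lambda>M n. invariant M \<and> M \<noteq> {0} \<and> M \<subseteq> K \<and> (\<forall>m g. orthogonal_family M m g \<longrightarrow> m \<le> n))"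
  have "K \<subseteq> H" using K by (simp add: invariant_def)
  then have "bounds K r"
    using K orthogonal_family_le[OF dim] by (auto simp: bounds_def)
  define n where "n = (LEAST n. \<exists>M. bounds M n)"
  have "\<exists>M. bounds M n" unfolding n_def by (rule LeastI_ex) (use \<open>bounds K r\<close> in blast)
  then obtain M where M: "bounds M n" by blast
  have minn: "n \<le> k" if "bounds M' k" for M' k
    unfolding n_def by (rule Least_le) (use that in blast)
  have Minv: "invariant M" "M \<noteq> {0}" "M \<subseteq> K" using M by (auto simp: bounds_def)
  have MH: "M \<subseteq> H" using Minv \<open>K \<subseteq> H\<close> by blast
  have "M' = M" if M': "invariant M'" "M' \<subseteq> M" "M' \<noteq> {0}" for M'
  proof -
    obtain x where x: "x \<in> M'" "x \<noteq> 0" using invariant_nonzero M' by blast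
    then have "orthogonal_family M 1 (\<lambda>_. x)" using M' by (auto simp: orthogonal_family_def)
    \<comment> \<open>A single nonzero vector is an orthogonal family of length 1. Thus
      \<open>n - 1\<close> is a true predecessor and leastness of n applies to it.\<close>
    then have "n \<ge> 1" using M by (auto simp: bounds_def)
    then have "\<not> bounds M' (n - 1)" using minn[of M' "n - 1"] by auto
    then obtain m g where g: "orthogonal_family M' m g" "m > n - 1"
      using M' Minv unfolding bounds_def by (metis dual_order.trans not_le)
    then have gM: "orthogonal_family M m g" using M' by (auto simp: orthogonal_family_def)
    have "m \<le> n" using M gM by (auto simp: bounds_def)
    with g \<open>n \<ge> 1\<close> have "m = n" by simp
    have gM': "\<And>j. j < m \<Longrightarrow> g j \<in> M'" using g by (auto simp: orthogonal_family_def)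
    \<comment> \<open>The family g lies in M' but has the greatest length possible in M, so the part
      of z orthogonal to g cannot extend it and is 0.\<close>
    have "z \<in> M'" if z: "z \<in> M" for z
    proof -
      obtain c where c: "\<And>i. i < m \<Longrightarrow> ip (g i) (z - (\<Sum>j<m. smul (g j) (c j))) = 0"
        using orthogonal_residual[OF MH gM, of z] z MH by blast
      have s: "(\<Sum>j<m. smul (g j) (c j)) \<in> M'"
        using gM' M'(1) by (intro invariant_sum) (auto simp: invariant_def)
      then have "z - (\<Sum>j<m. smul (g j) (c j)) \<in> M"
        using invariant_diff[OF Minv(1) z] M'(2) by blast
      moreover have "\<not> orthogonal_family M (Suc m) f" for f
        using M \<open>m = n\<close> by (auto simp: bounds_def)
      ultimately have "z - (\<Sum>j<m. smul (g j) (c j)) = 0"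
        using orthogonal_family_extend[OF MH gM _ _ c] by blast
      then show ?thesis using s by simp
    qed
    then show ?thesis using M'(2) by blast
  qed
  then show ?thesis using Minv unfolding minimal_invariant_def by blast
qed

text \<open>Schur's argument: the eigenspace of one real eigenvalue t is stable under A because
  real-valued functions are central, and stable under right scalars because t commutes with every
  quaternion. Minimality makes it all of K.\<close>

lemma minimal_real_scalar:
  assumes K: "minimal_invariant K" and h: "(\<lambda>a. of_real (h a)) \<in> A"
  shows "\<exists>t. \<forall>x\<in>K. op (\<lambda>a. of_real (h a)) x = smul x (of_real t)"
proof -
  have inv: "invariant K" using K by (simp add: minimal_invariant_def)
  then have KH: "\<And>x. x \<in> K \<Longrightarrow> x \<in> H" by (auto simp: invariant_def)
  obtain x where "x \<in> K" "x \<noteq> 0"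
    using invariant_nonzero[OF inv] K unfolding minimal_invariant_def by blast
  then obtain z t where z: "z \<in> K" "z \<noteq> 0" "op (\<lambda>a. of_real (h a)) z = smul z (of_real t)"
    using real_op_eigenvector[OF h inv] by blast
  define K' where "K' = {x \<in> K. op (\<lambda>a. of_real (h a)) x = smul x (of_real t)}"
  have "invariant K'"
    unfolding invariant_def K'_def
  proof (intro conjI ballI allI; (elim CollectE conjE)?)
    show "{x \<in> K. op (\<lambda>a. of_real (h a)) x = smul x (of_real t)} \<subseteq> H" using KH by blast
    show "0 \<in> {x \<in> K. op (\<lambda>a. of_real (h a)) x = smul x (of_real t)}"
      using inv h by (simp add: op_zero smul_zero_left invariant_def)
  next
    fix x z assume "x \<in> K" "z \<in> K" "op (\<lambda>a. of_real (h a)) x = smul x (of_real t)"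
      "op (\<lambda>a. of_real (h a)) z = smul z (of_real t)"
    then show "x + z \<in> {x \<in> K. op (\<lambda>a. of_real (h a)) x = smul x (of_real t)}"
      using inv h KH by (auto simp: op_add smul_add_left invariant_def)
  next
    fix x c assume x: "x \<in> K" "op (\<lambda>a. of_real (h a)) x = smul x (of_real t)"
    then have "op (\<lambda>a. of_real (h a)) (smul x c) = smul (smul x c) (of_real t)"
      using h KH by (simp add: op_smul smul_smul quat_of_real_commute)
    then show "smul x c \<in> {x \<in> K. op (\<lambda>a. of_real (h a)) x = smul x (of_real t)}"
      using x inv by (auto simp: invariant_def)
  next
    fix F x assume "F \<in> A" and x: "x \<in> K" "op (\<lambda>a. of_real (h a)) x = smul x (of_real t)"
    then have "op (\<lambda>a. of_real (h a)) (op F x) = smul (op F x) (of_real t)"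
      using h KH by (simp add: op_real_commute op_smul)
    then show "op F x \<in> {x \<in> K. op (\<lambda>a. of_real (h a)) x = smul x (of_real t)}"
      using x inv \<open>F \<in> A\<close> by (auto simp: invariant_def)
  qed
  moreover have "K' \<subseteq> K" "K' \<noteq> {0}" using z by (auto simp: K'_def)
  ultimately have "K' = K" using K by (simp add: minimal_invariant_def)
  then show ?thesis by (auto simp: K'_def)
qed

end


section \<open>Joint eigenvectors\<close>

context quat_function_rep
begin

definition imaginary :: "('p \<Rightarrow> quat) \<Rightarrow> bool" where
  "imaginary F \<longleftrightarrow> F \<in> A \<and> (\<forall>a. qRe (F a) = 0)"

text \<open>This relation and \<open>unit_on\<close> are imposed on operators restricted to K. The
  functions themselves need not satisfy them pointwise: anticommutators are constants only after
  restriction to a minimal subspace.\<close>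

definition anticommute_on :: "'h set \<Rightarrow> ('p \<Rightarrow> quat) \<Rightarrow> ('p \<Rightarrow> quat) \<Rightarrow> bool" where
  "anticommute_on K F G \<longleftrightarrow> (\<forall>x\<in>K. op F (op G x) + op G (op F x) = 0)"

definition unit_on :: "'h set \<Rightarrow> ('p \<Rightarrow> quat) \<Rightarrow> bool" where
  "unit_on K F \<longleftrightarrow> (\<forall>x\<in>K. op F (op F x) = - x)"

lemma imaginary_mem: "imaginary F \<Longrightarrow> F \<in> A"
  by (simp add: imaginary_def)

lemma imaginary_combine:
  "imaginary F \<Longrightarrow> imaginary G \<Longrightarrow> imaginary (\<lambda>a. F a + of_real t * G a)"
  unfolding imaginary_def using add_mem[OF _ scale_mem] by simp

lemma op_combine:
  "imaginary F \<Longrightarrow> imaginary G \<Longrightarrow> x \<in> H \<Longrightarrow>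
     op (\<lambda>a. F a + of_real t * G a) x = op F x + smul (op G x) (of_real t)"
  using op_fun_add[OF _ scale_mem, of F G x t] op_fun_scale[of G x t] by (simp add: imaginary_def)

text \<open>Conjugation negates imaginary values, so these operators are skew-adjoint.\<close>

lemma imaginary_adjoint:
  assumes "imaginary F" "x \<in> H" "z \<in> H"
  shows "ip (op F x) z = - ip x (op F z)"
proof -
  have F: "F \<in> A" using assms by (simp add: imaginary_def)
  have "(\<lambda>a. qcnj (F a)) = (\<lambda>a. of_real (- 1) * F a)"
    using assms by (auto simp: imaginary_def quat_eq_iff)
  then show ?thesis
    using op_adjoint[OF F assms(2,3)] op_fun_scale[OF F assms(3), of "- 1"] assms F
    by (simp add: smul_minus_right smul_one op_closed ip_minus_right)
qed

context
  fixes K :: "'h set"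
  assumes K: "minimal_invariant K"
begin

lemma K_invariant: "invariant K"
  using K by (simp add: minimal_invariant_def)

lemma K_H: "x \<in> K \<Longrightarrow> x \<in> H"
  using K_invariant by (auto simp: invariant_def)

lemma K_op: "F \<in> A \<Longrightarrow> x \<in> K \<Longrightarrow> op F x \<in> K"
  using K_invariant by (auto simp: invariant_def)

lemma K_smul: "x \<in> K \<Longrightarrow> smul x c \<in> K"
  using K_invariant by (auto simp: invariant_def)

lemma K_nonzero: "\<exists>x\<in>K. x \<noteq> 0"
  using invariant_nonzero[OF K_invariant] K by (simp add: minimal_invariant_def)

text \<open>The type \<open>'h\<close> is just an abelian group; division by 2 comes from the right
  quaternionic scalars.\<close>

lemma double_eq_0: "x \<in> H \<Longrightarrow> x + x = 0 \<Longrightarrow> x = 0"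
proof -
  assume x: "x \<in> H" "x + x = 0"
  have "smul x (1 + 1) = 0" using x smul_add_right[of x 1 1] by (simp add: smul_one)
  moreover have "(1 + 1 :: quat) \<noteq> 0" by (simp add: quat_eq_iff del: one_add_one)
  ultimately show "x = 0" using x by (simp only: smul_eq_0_iff) blast
qed

text \<open>For purely imaginary quaternions p and q, the sum p q + q p is real: it is -2 times
  their Euclidean inner product.\<close>

lemma anticommutator_scalar:
  assumes F: "imaginary F" and G: "imaginary G"
  shows "\<exists>t. \<forall>x\<in>K. op F (op G x) + op G (op F x) = smul x (of_real t)"
proof -
  have FG: "F \<in> A" "G \<in> A" using F G by (simp_all add: imaginary_def)
  define h where "h = (\<lambda>a. qRe (F a * G a + G a * F a))"
  have h: "(\<lambda>a. F a * G a + G a * F a) = (\<lambda>a. of_real (h a))"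
    unfolding fun_eq_iff quat_eq_iff of_real_quat_sel h_def
    using F G by (simp add: imaginary_def algebra_simps)
  have "(\<lambda>a. of_real (h a)) \<in> A"
    unfolding h[symmetric] using FG by (intro add_mem mult_mem)
  then obtain t where "\<forall>x\<in>K. op (\<lambda>a. of_real (h a)) x = smul x (of_real t)"
    using minimal_real_scalar[OF K] by blast
  moreover have "op (\<lambda>a. of_real (h a)) x = op F (op G x) + op G (op F x)" if "x \<in> K" for x
    unfolding h[symmetric]
    using op_fun_add[OF mult_mem mult_mem, OF FG FG(2,1)] FG K_H[OF that] by (simp add: op_fun_mult)
  ultimately show ?thesis by metis
qed

text \<open>F squares to a real scalar t on K. Skew-adjointness gives <F x0, F x0> = - t <x0, x0>,
  so t < 0, and scaling by 1 / sqrt (- t) makes the square equal to -1.\<close>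

lemma normalize_imaginary:
  assumes F: "imaginary F" and x0: "x0 \<in> K" "op F x0 \<noteq> 0"
  shows "\<exists>s. s \<noteq> 0 \<and> imaginary (\<lambda>a. of_real s * F a) \<and> unit_on K (\<lambda>a. of_real s * F a)"
proof -
  have FA: "F \<in> A" using F by (simp add: imaginary_def)
  obtain t0 where t0: "\<And>x. x \<in> K \<Longrightarrow> op F (op F x) + op F (op F x) = smul x (of_real t0)"
    using anticommutator_scalar[OF F F] by blast
  \<comment> \<open>The anticommutator of F with itself is twice its square.\<close>
  define t where "t = t0 / 2"
  have t: "op F (op F x) = smul x (of_real t)" if "x \<in> K" for x
  proof -
    have x: "x \<in> H" "op F (op F x) \<in> H" using that FA K_H K_op by auto
    have "smul x (of_real t) + smul x (of_real t) = smul x (of_real t0)"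
      using x by (simp add: smul_add_right[symmetric] t_def flip: of_real_add del: of_real_divide)
    then have "(op F (op F x) - smul x (of_real t)) + (op F (op F x) - smul x (of_real t)) = 0"
      using t0[OF that] by (simp add: algebra_simps)
    then have "op F (op F x) - smul x (of_real t) = 0"
      using x diff_closed smul_closed double_eq_0 by blast
    then show ?thesis by simp
  qed
  have x0H: "x0 \<in> H" "op F x0 \<in> H" using x0 FA K_H K_op by auto
  have "ip (op F x0) (op F x0) = - (ip x0 x0 * of_real t)"
    using imaginary_adjoint[OF F x0H] t[OF x0(1)] x0H by (simp add: ip_smul_right)
  then have eq: "qRe (ip (op F x0) (op F x0)) = - (qRe (ip x0 x0) * t)" by simp
  have "qRe (ip (op F x0) (op F x0)) > 0" using x0H x0 ip_self_pos by blast
  moreover have "qRe (ip x0 x0) \<ge> 0" using x0H ip_nonneg by blast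
  ultimately have "t < 0" using eq by (smt (verit) mult_nonneg_nonneg)
  define s where "s = 1 / sqrt (- t)"
  have s: "s \<noteq> 0" "t * s * s = - 1"
    using \<open>t < 0\<close> by (auto simp: s_def)
  have "imaginary (\<lambda>a. of_real s * F a)"
    using F scale_mem[OF FA] by (simp add: imaginary_def)
  moreover have "unit_on K (\<lambda>a. of_real s * F a)"
    unfolding unit_on_def
  proof
    fix x assume x: "x \<in> K"
    have "op (\<lambda>a. of_real s * F a) (op (\<lambda>a. of_real s * F a) x) =
        smul (op F (smul (op F x) (of_real s))) (of_real s)"
      using x K_H K_op FA by (simp add: op_fun_scale smul_closed)
    also have "\<dots> = smul x (of_real t * of_real s * of_real s)"
      using x K_H K_op FA t by (simp add: op_smul smul_smul smul_closed mult.assoc)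
    also have "\<dots> = - x"
      using s(2) x K_H by (simp add: smul_minus_right smul_one flip: of_real_mult)
    finally show "op (\<lambda>a. of_real s * F a) (op (\<lambda>a. of_real s * F a) x) = - x" .
  qed
  ultimately show ?thesis using s(1) by blast
qed

lemma anticommute_on_sym: "anticommute_on K F G \<Longrightarrow> anticommute_on K G F"
  by (simp add: anticommute_on_def add.commute)

lemma anticommute_combine:
  assumes "imaginary F" "imaginary G" "imaginary I" "anticommute_on K F I" "anticommute_on K G I"
  shows "anticommute_on K (\<lambda>a. F a + of_real t * G a) I"
  unfolding anticommute_on_def
proof
  fix x assume x: "x \<in> K"
  let ?t = "of_real t :: quat"
  have m: "F \<in> A" "G \<in> A" "I \<in> A" using assms by (simp_all add: imaginary_def)
  have H: "x \<in> H" "op I x \<in> H" "op F x \<in> H" "op G x \<in> H" "op F (op I x) \<in> H" "op G (op I x) \<in> H"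
     "op I (op F x) \<in> H" "op I (op G x) \<in> H"
    using x m by (auto intro!: K_H K_op)
  have "op (\<lambda>a. F a + of_real t * G a) (op I x) + op I (op (\<lambda>a. F a + of_real t * G a) x) =
      (op F (op I x) + op I (op F x)) + smul (op G (op I x) + op I (op G x)) ?t"
    using assms H m by (simp add: op_combine op_add op_smul smul_add_left smul_closed algebra_simps)
  also have "\<dots> = 0" using assms(4,5) x by (simp add: anticommute_on_def smul_zero_left)
  finally show "op (\<lambda>a. F a + of_real t * G a) (op I x) + op I (op (\<lambda>a. F a + of_real t * G a) x) = 0" .
qed

text \<open>Gram-Schmidt for the scalar-valued form given by the anticommutator.\<close>

lemma orthogonalize:
  assumes G: "imaginary G" and I: "imaginary I" "unit_on K I"
  shows "\<exists>t. anticommute_on K (\<lambda>a. G a + of_real t * I a) I"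
proof -
  have m: "G \<in> A" "I \<in> A" using assms by (simp_all add: imaginary_def)
  obtain t where t: "\<And>x. x \<in> K \<Longrightarrow> op G (op I x) + op I (op G x) = smul x (of_real t)"
    using anticommutator_scalar[OF G I(1)] by blast
  \<comment> \<open>Adding s I to G changes the anticommutator with I by 2 s I^2 = - 2 s, which has
    to cancel t.\<close>
  define s where "s = t / 2"
  let ?t = "of_real s :: quat"
  have "anticommute_on K (\<lambda>a. G a + ?t * I a) I"
    unfolding anticommute_on_def
  proof
    fix x assume x: "x \<in> K"
    have H: "x \<in> H" "op I x \<in> H" "op G x \<in> H" "op G (op I x) \<in> H" "op I (op G x) \<in> H"
      using x m by (auto intro!: K_H K_op)
    have II: "op I (op I x) = - x" using I(2) x by (simp add: unit_on_def)
    have "op (\<lambda>a. G a + ?t * I a) (op I x) + op I (op (\<lambda>a. G a + ?t * I a) x) =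
        (op G (op I x) + op I (op G x)) + (smul (op I (op I x)) ?t + smul (op I (op I x)) ?t)"
      using assms H m by (simp add: op_combine op_add op_smul smul_closed algebra_simps)
    also have "\<dots> = smul x (of_real t) - (smul x ?t + smul x ?t)"
      using t[OF x] H(1) II by (simp add: smul_minus_left)
    also have "\<dots> = 0"
      using H(1) by (simp add: smul_add_right[symmetric] s_def flip: of_real_add del: of_real_divide)
    finally show "op (\<lambda>a. G a + ?t * I a) (op I x) + op I (op (\<lambda>a. G a + ?t * I a) x) = 0" .
  qed
  then show ?thesis by blast
qed

text \<open>Fixed quaternion units used as right scalars; all operators commute with them.\<close>

abbreviation (input) "ui \<equiv> Quat 0 1 0 0"
abbreviation (input) "uj \<equiv> Quat 0 0 1 0"

text \<open>The map S x = (I x) \<open>ui\<close> is an involution, as I and right multiplication by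
  \<open>ui\<close> commute and both square to -1. Hence f = x - S x satisfies S f = - f, which says
  I f = f \<open>ui\<close>.\<close>

lemma unit_eigenvector:
  assumes I: "imaginary I" "unit_on K I"
  shows "\<exists>x\<in>K. x \<noteq> 0 \<and> op I x = smul x ui"
proof -
  have m: "I \<in> A" using I by (simp add: imaginary_def)
  obtain x where x: "x \<in> K" "x \<noteq> 0" using K_nonzero by blast
  have H: "x \<in> H" "op I x \<in> H" using x m K_H K_op by auto
  have II: "op I (op I x) = - x" using I(2) x by (simp add: unit_on_def)
  have uu: "ui * ui = - 1" by (simp add: quat_eq_iff)
  let ?f = "x - smul (op I x) ui"
  show ?thesis
  proof (cases "?f = 0")
    case False
    have "op I ?f = op I x + smul x ui"
      using H m II by (simp add: op_diff op_smul smul_closed smul_minus_left)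
    also have "\<dots> = smul ?f ui"
      using H by (simp add: smul_diff_left smul_closed smul_smul uu smul_minus_right smul_one)
    finally have "op I ?f = smul ?f ui" .
    moreover have "?f \<in> K"
      using x m by (intro invariant_diff[OF K_invariant] K_smul K_op)
    ultimately show ?thesis using False by blast
  next
    case True
    then have "smul x ui = smul (smul (op I x) ui) ui" by simp
    then have Ix: "op I x = smul x (- ui)"
      using H by (simp add: smul_smul uu smul_minus_right smul_one)
    \<comment> \<open>When f = 0, x has eigenvalue - \<open>ui\<close>; right multiplication of x by
      \<open>uj\<close> conjugates this into \<open>ui\<close>.\<close>
    have "- ui * uj = uj * ui" by (simp add: quat_eq_iff)
    then have "op I (smul x uj) = smul (smul x uj) ui"
      using H m by (simp add: op_smul Ix smul_smul)
    moreover have "smul x uj \<noteq> 0" using x H by (auto simp: smul_eq_0_iff quat_eq_iff)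
    ultimately show ?thesis using K_smul[OF x(1)] by blast
  qed
qed

text \<open>Start from x with I x = x \<open>ui\<close> and correct it for J with \<open>uj\<close>.
  The correction keeps the eigenvalue \<open>ui\<close> of I: the sign from I J = - J I cancels the
  sign from \<open>ui\<close> and \<open>uj\<close> anticommuting. If the corrected vector is 0, x
  itself is an eigenvector of J.\<close>

lemma two_units_eigenvector:
  assumes I: "imaginary I" "unit_on K I" and J: "imaginary J" "unit_on K J"
    and IJ: "anticommute_on K I J"
  shows "\<exists>f\<in>K. f \<noteq> 0 \<and> (\<exists>c. op I f = smul f c) \<and> (\<exists>c. op J f = smul f c)"
proof -
  have m: "I \<in> A" "J \<in> A" using I J by (simp_all add: imaginary_def)
  obtain x where x: "x \<in> K" "x \<noteq> 0" "op I x = smul x ui" using unit_eigenvector[OF I] by blast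
  have H: "x \<in> H" "op I x \<in> H" "op J x \<in> H" using x(1) m K_H K_op by auto
  have JJ: "op J (op J x) = - x" using J(2) x by (simp add: unit_on_def)
  have "op I (op J x) + op J (op I x) = 0"
    using IJ x(1) unfolding anticommute_on_def by blast
  then have IJx: "op I (op J x) = - smul (op J x) ui"
    using x m H by (simp add: op_smul eq_neg_iff_add_eq_0)
  have uu: "uj * uj = - 1" "ui * uj = - (uj * ui)" by (simp_all add: quat_eq_iff)
  let ?f = "x - smul (op J x) uj"
  show ?thesis
  proof (cases "?f = 0")
    case False
    have "op J ?f = op J x + smul x uj"
      using H m JJ by (simp add: op_diff op_smul smul_closed smul_minus_left)
    also have "\<dots> = smul ?f uj"
      using H by (simp add: smul_diff_left smul_closed smul_smul uu smul_minus_right smul_one)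
    finally have J: "op J ?f = smul ?f uj" .
    have "op I ?f = smul x ui + smul (op J x) (ui * uj)"
      using H m IJx x(3) by (simp add: op_diff op_smul smul_closed smul_minus_left smul_smul)
    also have "\<dots> = smul ?f ui"
      using H by (simp add: smul_diff_left smul_closed smul_smul uu(2) smul_minus_right)
    finally have I: "op I ?f = smul ?f ui" .
    have "?f \<in> K"
      using x m by (intro invariant_diff[OF K_invariant] K_smul K_op)
    with I J False show ?thesis by blast
  next
    case True
    then have "smul x uj = smul (smul (op J x) uj) uj" by simp
    then have "op J x = smul x (- uj)"
      using H by (simp add: smul_smul uu smul_minus_right smul_one)
    with x show ?thesis by blast
  qed
qed

lemma imaginary_vanishes:
  assumes I: "imaginary I" "unit_on K I" and J: "imaginary J" "unit_on K J"
    and L: "imaginary L" "\<And>x. x \<in> K \<Longrightarrow> op L x = op I (op J x)"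
    and G: "imaginary G" "anticommute_on K G I" "anticommute_on K G J" "anticommute_on K G L"
    and x: "x \<in> K"
  shows "op G x = 0"
proof -
  have m: "I \<in> A" "J \<in> A" "L \<in> A" "G \<in> A" using I J L G by (simp_all add: imaginary_def)
  (* G commutes with IJ, as it anticommutes with both I and J, but it anticommutes with L = IJ. *)
  let ?z = "op I (op J (op G x))"
  have k: "op G x \<in> K" "op J x \<in> K" "op J (op G x) \<in> K" "?z \<in> K" using x m K_op by auto
  have zH: "?z \<in> H" "op G x \<in> H" "op J (op G x) \<in> H" "op G (op J x) \<in> H" using k x m K_H K_op by auto
  have "op G (op I (op J x)) + op I (op G (op J x)) = 0" using G(2) k by (simp add: anticommute_on_def)
  moreover have "op G (op J x) + op J (op G x) = 0" using G(3) x by (simp add: anticommute_on_def)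
  then have "op G (op J x) = - op J (op G x)" by (simp add: eq_neg_iff_add_eq_0)
  ultimately have "op G (op I (op J x)) = ?z"
    using m zH by (simp add: op_minus eq_neg_iff_add_eq_0)
  moreover have "op G (op L x) + op L (op G x) = 0" using G(4) x by (simp add: anticommute_on_def)
  ultimately have "?z + ?z = 0" using L(2) x k by simp
  then have "?z = 0" using zH double_eq_0 by blast
  then have "op J (op I ?z) = 0" using m by (simp add: op_zero)
  moreover have "op I ?z = - op J (op G x)" using I(2) k by (simp add: unit_on_def)
  moreover have "op J (op J (op G x)) = - op G x" using J(2) k by (simp add: unit_on_def)
  ultimately show ?thesis using m zH by (simp add: op_minus)
qed

text \<open>Closure under conjugation puts the real part (F + conj F) / 2 into A, where it acts on K
  as a real scalar; only the imaginary part is left.\<close>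

lemma eigenvector_of_imaginary:
  assumes f: "f \<in> K" and ev: "\<And>G. imaginary G \<Longrightarrow> \<exists>c. op G f = smul f c" and F: "F \<in> A"
  shows "\<exists>c. op F f = smul f c"
proof -
  define R where "R = (\<lambda>a. of_real (1 / 2) * (F a + qcnj (F a)))"
  have R: "R \<in> A" unfolding R_def using F by (intro scale_mem add_mem cnj_mem)
  have Rr: "R = (\<lambda>a. of_real (qRe (F a)))"
    unfolding R_def fun_eq_iff quat_eq_iff quat_mult_sel of_real_quat_sel by simp
  have "imaginary (\<lambda>a. F a - R a)"
    using diff_mem[OF F R] by (simp add: imaginary_def Rr)
  then obtain c where c: "op (\<lambda>a. F a - R a) f = smul f c" using ev by blast
  obtain t where t: "op R f = smul f (of_real t)"
    using minimal_real_scalar[OF K R[unfolded Rr]] f unfolding Rr by blast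
  have "op F f = smul f c + smul f (of_real t)"
    using op_fun_diff[OF F R K_H[OF f]] c t by (simp add: algebra_simps)
  then show ?thesis using smul_add_right[OF K_H[OF f]] by metis
qed

text \<open>Three cases as in Frobenius' theorem: on K the imaginary functions act as 0, as real
  multiples of one unit I, or as real combinations of I, J and L = IJ.\<close>

lemma joint_eigenvector: "\<exists>f\<in>K. f \<noteq> 0 \<and> (\<forall>F\<in>A. \<exists>c. op F f = smul f c)"
proof -
  have "\<exists>f\<in>K. f \<noteq> 0 \<and> (\<forall>G. imaginary G \<longrightarrow> (\<exists>c. op G f = smul f c))"
  proof (cases "\<exists>F x. imaginary F \<and> x \<in> K \<and> op F x \<noteq> 0")
    case False
    obtain f where f: "f \<in> K" "f \<noteq> 0" using K_nonzero by blast
    have "op G f = smul f 0" if "imaginary G" for G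
      using that False f K_H by (auto simp: smul_zero_right)
    with f show ?thesis by blast
  next
    case True
    then obtain I where I: "imaginary I" "unit_on K I" using normalize_imaginary by metis
    note mI = imaginary_mem[OF I(1)]
    show ?thesis
    proof (cases "\<forall>G. imaginary G \<longrightarrow> (\<exists>t. \<forall>x\<in>K. op G x + smul (op I x) (of_real t) = 0)")
      case True
      obtain f where f: "f \<in> K" "f \<noteq> 0" "op I f = smul f ui" using unit_eigenvector[OF I] by blast
      have "\<exists>c. op G f = smul f c" if G: "imaginary G" for G
      proof -
        obtain t where "op G f + smul (op I f) (of_real t) = 0" using True G f by blast
        then have "op G f = - smul f (ui * of_real t)"
          using f K_H by (simp add: eq_neg_iff_add_eq_0 smul_smul)
        also have "\<dots> = smul f (- (ui * of_real t))" using f K_H by (simp only: smul_minus_right)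
        finally show ?thesis by blast
      qed
      with f show ?thesis by blast
    next
      case False
      then obtain J0 where J0: "imaginary J0"
          "\<And>t. \<exists>x\<in>K. op J0 x + smul (op I x) (of_real t) \<noteq> 0" by blast
      obtain t where t: "anticommute_on K (\<lambda>a. J0 a + of_real t * I a) I"
        using orthogonalize[OF J0(1) I] by blast
      define J1 where "J1 = (\<lambda>a. J0 a + of_real t * I a)"
      have J1: "imaginary J1" unfolding J1_def by (rule imaginary_combine[OF J0(1) I(1)])
      \<comment> \<open>If J1 vanished on K, then J0 would act there as a real multiple of I, which
        this case excludes.\<close>
      obtain x where x: "x \<in> K" "op J1 x \<noteq> 0"
        using J0(2)[of t] op_combine[OF J0(1) I(1) K_H] unfolding J1_def by metis
      obtain s where s: "imaginary (\<lambda>a. of_real s * J1 a)" "unit_on K (\<lambda>a. of_real s * J1 a)"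
        using normalize_imaginary[OF J1 x] by blast
      define J where "J = (\<lambda>a. of_real s * J1 a)"
      have J: "imaginary J" "unit_on K J" using s by (simp_all add: J_def)
      note mJ = imaginary_mem[OF J(1)]
      have IJ: "anticommute_on K I J"
        unfolding anticommute_on_def
      proof
        fix x assume x: "x \<in> K"
        note mJ1 = imaginary_mem[OF J1]
        have H: "op J1 x \<in> H" "x \<in> H" "op I x \<in> H" "op I (op J1 x) \<in> H" "op J1 (op I x) \<in> H"
          using x mI mJ1 K_H K_op by auto
        have "op I (op J x) + op J (op I x) =
            smul (op J1 (op I x) + op I (op J1 x)) (of_real s)"
          using H mI mJ1 by (simp add: J_def op_fun_scale op_smul smul_add_left add.commute)
        also have "\<dots> = 0"
          using t x by (simp add: anticommute_on_def J1_def smul_zero_left)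
        finally show "op I (op J x) + op J (op I x) = 0" .
      qed
      then have JI: "op J (op I x) = - op I (op J x)" if "x \<in> K" for x
        using that by (simp add: anticommute_on_def eq_neg_iff_add_eq_0 add.commute)
      have II: "op I (op I x) = - x" "op J (op J x) = - x" if "x \<in> K" for x
        using I J that by (simp_all add: unit_on_def)
      \<comment> \<open>The pointwise product of I and J need not be imaginary, but half their
        commutator is, and on K it acts as IJ since JI = - IJ there.\<close>
      define L where "L = (\<lambda>a. of_real (1 / 2) * (I a * J a - J a * I a))"
      have L: "imaginary L"
        unfolding imaginary_def
      proof (intro conjI allI)
        show "L \<in> A" unfolding L_def by (intro scale_mem diff_mem mult_mem mI mJ)
        show "qRe (L a) = 0" for a
          unfolding L_def quat_mult_sel of_real_quat_sel quat_add_sel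
          using I(1) J(1) by (simp add: imaginary_def)
      qed
      have Lop: "op L x = op I (op J x)" if x: "x \<in> K" for x
      proof -
        have H: "x \<in> H" "op I (op J x) \<in> H" using x mI mJ K_H K_op by auto
        have "op L x = smul (op I (op J x) - op J (op I x)) (of_real (1 / 2))"
          unfolding L_def op_fun_scale[OF diff_mem[OF mult_mem[OF mI mJ] mult_mem[OF mJ mI]] H(1)]
            op_fun_diff[OF mult_mem[OF mI mJ] mult_mem[OF mJ mI] H(1)]
            op_fun_mult[OF mI mJ H(1)] op_fun_mult[OF mJ mI H(1)] by (rule refl)
        also have "\<dots> = smul (op I (op J x)) (of_real (1 / 2)) + smul (op I (op J x)) (of_real (1 / 2))"
          using JI[OF x] H by (simp add: smul_add_left)
        also have "\<dots> = smul (op I (op J x)) (of_real (1 / 2) + of_real (1 / 2))"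
          using smul_add_right[OF H(2)] by simp
        also have "\<dots> = op I (op J x)"
          using H by (simp add: smul_one del: of_real_divide flip: of_real_add)
        finally show ?thesis .
      qed
      note mL = imaginary_mem[OF L]
      have "anticommute_on K I L" "anticommute_on K J L" "unit_on K L"
        unfolding anticommute_on_def unit_on_def
      proof safe
        fix x assume x: "x \<in> K"
        have k: "op I x \<in> K" "op J x \<in> K" "op I (op J x) \<in> K" using x mI mJ K_op by auto
        have H: "x \<in> H" "op I x \<in> H" "op J x \<in> H" "op I (op J x) \<in> H" using x k K_H by auto
        show "op I (op L x) + op L (op I x) = 0"
          using x k H mI mJ by (simp add: Lop II JI op_minus)
        show "op J (op L x) + op L (op J x) = 0"
          using x k H mI mJ by (simp add: Lop II JI op_minus)
        show "op L (op L x) = - x"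
          using x k H mI mJ by (simp add: Lop II JI op_minus)
      qed
      note LIJ = this
      obtain f where f: "f \<in> K" "f \<noteq> 0" and cd: "\<exists>c. op I f = smul f c" "\<exists>c. op J f = smul f c"
        using two_units_eigenvector[OF I J IJ] by blast
      obtain c where c: "op I f = smul f c" using cd by blast
      obtain c' where c': "op J f = smul f c'" using cd by blast
      have "\<exists>e. op G f = smul f e" if G: "imaginary G" for G
      proof -
        \<comment> \<open>Successive orthogonalisation against I, J and L; each step keeps the
          earlier relations because I, J and L anticommute pairwise on K.\<close>
        obtain t1 where t1: "anticommute_on K (\<lambda>a. G a + of_real t1 * I a) I"
          using orthogonalize[OF G I] by blast
        define G1 where "G1 = (\<lambda>a. G a + of_real t1 * I a)"
        have G1: "imaginary G1" unfolding G1_def by (rule imaginary_combine[OF G I(1)])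
        obtain t2 where t2: "anticommute_on K (\<lambda>a. G1 a + of_real t2 * J a) J"
          using orthogonalize[OF G1 J] by blast
        define G2 where "G2 = (\<lambda>a. G1 a + of_real t2 * J a)"
        have G2: "imaginary G2" unfolding G2_def by (rule imaginary_combine[OF G1 J(1)])
        have G2I: "anticommute_on K G2 I"
          unfolding G2_def using t1 IJ anticommute_on_sym
          by (intro anticommute_combine G1 J I) (auto simp: G1_def)
        obtain t3 where t3: "anticommute_on K (\<lambda>a. G2 a + of_real t3 * L a) L"
          using orthogonalize[OF G2 L LIJ(3)] by blast
        define G3 where "G3 = (\<lambda>a. G2 a + of_real t3 * L a)"
        have G3: "imaginary G3" unfolding G3_def by (rule imaginary_combine[OF G2 L])
        have G3I: "anticommute_on K G3 I"
          unfolding G3_def by (intro anticommute_combine G2 L I G2I anticommute_on_sym[OF LIJ(1)])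
        have G3J: "anticommute_on K G3 J"
          unfolding G3_def using t2
          by (intro anticommute_combine G2 L J anticommute_on_sym[OF LIJ(2)]) (simp add: G2_def)
        have fH: "f \<in> H" using f K_H by blast
        \<comment> \<open>From J f = f c' and I f = f c follows I (J f) = (I f) c' = f c c', so f is
          an eigenvector of L as well, and hence of every combination of I, J and L.\<close>
        have Lf: "op L f = smul f (c * c')"
          using Lop[OF f(1)] fH mI by (simp add: c c' op_smul smul_smul)
        have "op G3 f = 0"
          using t3 by (intro imaginary_vanishes[OF I J L Lop G3 G3I G3J _ f(1)]) (simp_all add: G3_def)
        moreover have "op G3 f = op G f + smul f (c * of_real t1) + smul f (c' * of_real t2)
            + smul f (c * c' * of_real t3)"
          unfolding G3_def op_combine[OF G2 L fH]
          unfolding G2_def op_combine[OF G1 J(1) fH]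
          unfolding G1_def op_combine[OF G I(1) fH]
          using fH by (simp add: c c' Lf smul_smul)
        ultimately have "op G f + smul f (c * of_real t1 + c' * of_real t2 + c * c' * of_real t3) = 0"
          using fH by (simp add: smul_add_right add.assoc)
        then have "op G f = - smul f (c * of_real t1 + c' * of_real t2 + c * c' * of_real t3)"
          by (simp only: eq_neg_iff_add_eq_0)
        then have "op G f = smul f (- (c * of_real t1 + c' * of_real t2 + c * c' * of_real t3))"
          by (simp only: smul_minus_right[OF fH])
        then show ?thesis by blast
      qed
      with f show ?thesis by blast
    qed
  qed
  then show ?thesis using eigenvector_of_imaginary by blast
qed

end

text \<open>A maximal orthogonal family of joint eigenvectors spans: a nonzero orthogonal complement
  would contain a minimal invariant subspace, and a joint eigenvector from it would lengthen the
  family.\<close>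

theorem eigenvector_decomposition:
  obtains n f where "n \<le> r" "\<And>i. i < n \<Longrightarrow> f i \<in> H"
    "\<And>i F. i < n \<Longrightarrow> F \<in> A \<Longrightarrow> \<exists>c. op F (f i) = smul (f i) c"
    "\<And>i j. i < n \<Longrightarrow> j < n \<Longrightarrow> i \<noteq> j \<Longrightarrow> ip (f i) (f j) = 0"
    "\<And>x. x \<in> H \<Longrightarrow> \<exists>c. x = (\<Sum>i<n. smul (f i) (c i))"
proof -
  define E where "E = {f \<in> H. \<forall>F\<in>A. \<exists>c. op F f = smul f c}"
  have EH: "E \<subseteq> H" by (auto simp: E_def)
  obtain n f where nf: "orthogonal_family E n f" and max: "\<And>m g. orthogonal_family E m g \<Longrightarrow> m \<le> n"
    using maximal_orthogonal_family[OF dim EH] by blast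
  have fE: "f i \<in> E" if "i < n" for i using nf that by (simp add: orthogonal_family_def)
  then have fH: "f i \<in> H" if "i < n" for i using EH that by blast
  define K where "K = {x \<in> H. \<forall>i<n. ip (f i) x = 0}"
  have "invariant K"
    unfolding invariant_def
  proof (intro conjI ballI allI)
    show "K \<subseteq> H" by (auto simp: K_def)
    show "0 \<in> K" using fH by (simp add: K_def zero_closed ip_zero_right)
    show "x + z \<in> K" if "x \<in> K" "z \<in> K" for x z
      using that fH by (simp add: K_def add_closed ip_add_right)
    show "smul x c \<in> K" if "x \<in> K" for x c
      using that fH by (simp add: K_def smul_closed ip_smul_right)
    show "op F x \<in> K" if F: "F \<in> A" and x: "x \<in> K" for F x
    proof -
      have xH: "x \<in> H" using x by (simp add: K_def)
      have "ip (f i) (op F x) = 0" if i: "i < n" for i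
      proof -
        \<comment> \<open>To move F to the other side of the inner product, f i has to be an
          eigenvector of the conjugate function too.\<close>
        have F': "(\<lambda>a. qcnj (F a)) \<in> A" using F by (rule cnj_mem)
        then obtain c where c: "op (\<lambda>a. qcnj (F a)) (f i) = smul (f i) c"
          using fE[OF i] by (auto simp: E_def)
        have "ip (f i) (op F x) = ip (op (\<lambda>a. qcnj (F a)) (f i)) x"
          using op_adjoint[OF F' fH[OF i] xH] by simp
        also have "\<dots> = 0" using c x fH[OF i] xH i by (simp add: ip_smul_left K_def)
        finally show ?thesis .
      qed
      then show ?thesis using F xH by (simp add: K_def op_closed)
    qed
  qed
  have K0: "K = {0}"
  proof (rule ccontr)
    assume "K \<noteq> {0}"
    then obtain M where M: "minimal_invariant M" "M \<subseteq> K"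
      using minimal_invariant_exists \<open>invariant K\<close> by blast
    obtain e where e: "e \<in> M" "e \<noteq> 0" "\<forall>F\<in>A. \<exists>c. op F e = smul e c"
      using joint_eigenvector[OF M(1)] by blast
    then have "e \<in> K" using M by blast
    then have "e \<in> E" using e by (simp add: E_def K_def)
    then have "orthogonal_family E (Suc n) (f(n := e))"
      using orthogonal_family_extend[OF EH nf] e(2) \<open>e \<in> K\<close> by (simp add: K_def)
    then show False using max by fastforce
  qed
  have "\<exists>c. x = (\<Sum>i<n. smul (f i) (c i))" if x: "x \<in> H" for x
  proof -
    obtain c where c: "\<forall>i<n. ip (f i) (x - (\<Sum>j<n. smul (f j) (c j))) = 0"
      using orthogonal_residual[OF EH nf x] by blast
    have "x - (\<Sum>j<n. smul (f j) (c j)) \<in> H"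
      using x fH by (intro diff_closed sum_closed smul_closed) simp_all
    with c have "x - (\<Sum>j<n. smul (f j) (c j)) \<in> K" by (simp add: K_def)
    with K0 show ?thesis by auto
  qed
  moreover have "n \<le> r" by (rule orthogonal_family_le[OF dim EH nf])
  moreover have "\<exists>c. op F (f i) = smul (f i) c" if "i < n" "F \<in> A" for i F
    using fE that by (auto simp: E_def)
  moreover have "ip (f i) (f j) = 0" if "i < n" "j < n" "i \<noteq> j" for i j
    using nf that by (simp add: orthogonal_family_def)
  ultimately show ?thesis using that fH by blast
qed

end


section \<open>The flat representation\<close>

lemma finite_UNIV_letter: "finite (UNIV :: 'n::finite letter set)"
proof -
  have "(UNIV :: 'n letter set) = range Q \<union> range Qbar"
    by (auto simp: image_iff) (metis letter.exhaust)
  then show ?thesis by (metis finite finite_Un finite_imageI)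
qed

lemma finite_words_upto: "finite (words_upto t :: 'n::finite qword set)"
  using finite_lists_length_le[OF finite_UNIV_letter, of t] by (simp add: words_upto_def)

lemma letter_star_star [simp]: "letter_star (letter_star a) = a"
  by (cases a) simp_all

lemma letter_eval_star [simp]: "letter_eval q (letter_star a) = qcnj (letter_eval q a)"
  by (cases a) simp_all

lemma word_star_simps [simp]:
  "word_star [] = []" "word_star (a # w) = word_star w @ [letter_star a]"
  "word_star (u @ w) = word_star w @ word_star u" "word_star (word_star w) = w"
  "length (word_star w) = length w"
  by (simp_all add: word_star_def rev_map o_def)

lemma word_eval_simps [simp]:
  "word_eval q [] = 1" "word_eval q (a # w) = letter_eval q a * word_eval q w"
  "word_eval q (u @ w) = word_eval q u * word_eval q w"
  by (simp_all add: word_eval_def)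

lemma word_eval_star [simp]: "word_eval q (word_star w) = qcnj (word_eval q w)"
  by (induction w) simp_all

lemma qpoly_eval_superset:
  assumes "finite S" "Poly_Mapping.keys p \<subseteq> S"
  shows "qpoly_eval q p = (\<Sum>w\<in>S. of_real (Poly_Mapping.lookup p w) * word_eval q w)"
  unfolding qpoly_eval_def using assms
  by (intro sum.mono_neutral_left) (auto simp: in_keys_iff)

lemma qpoly_eval_add: "qpoly_eval q (p + p') = qpoly_eval q p + qpoly_eval q p'"
proof -
  let ?S = "Poly_Mapping.keys p \<union> Poly_Mapping.keys p' \<union> Poly_Mapping.keys (p + p')"
  have "qpoly_eval q t = (\<Sum>w\<in>?S. of_real (Poly_Mapping.lookup t w) * word_eval q w)"
    if "t \<in> {p, p', p + p'}" for t
    using that by (intro qpoly_eval_superset) auto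
  then show ?thesis by (simp add: lookup_add algebra_simps sum.distrib)
qed

lemma qpoly_eval_diff: "qpoly_eval q (p - p') = qpoly_eval q p - qpoly_eval q p'"
  using qpoly_eval_add[of q "p - p'" p'] by simp

lemma qpoly_eval_single: "qpoly_eval q (Poly_Mapping.single w t) = of_real t * word_eval q w"
  using qpoly_eval_superset[of "{w}" "Poly_Mapping.single w t" q] by simp

lemma qpoly_eval_zero: "qpoly_eval q 0 = 0"
  by (simp add: qpoly_eval_def)

lemma qpoly_eval_sum: "qpoly_eval q (sum p I) = (\<Sum>i\<in>I. qpoly_eval q (p i))"
  by (induction I rule: infinite_finite_induct) (simp_all add: qpoly_eval_add qpoly_eval_zero)

context right_quat_inner_space
begin

lemma right_linear_on_sum:
  assumes T: "right_linear_on H smul T" and "\<And>i. i \<in> I \<Longrightarrow> g i \<in> H"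
  shows "T (\<Sum>i\<in>I. smul (g i) (c i)) = (\<Sum>i\<in>I. smul (T (g i)) (c i))"
proof -
  have zero: "T 0 = 0"
    using T zero_closed unfolding right_linear_on_def by (metis add_cancel_right_left add.right_neutral)
  show ?thesis
    using assms(2)
  proof (induction I rule: infinite_finite_induct)
    case (insert i I)
    have "smul (g i) (c i) \<in> H" "(\<Sum>i\<in>I. smul (g i) (c i)) \<in> H"
      using insert by (auto intro!: smul_closed sum_closed)
    with insert T show ?case by (simp add: right_linear_on_def)
  qed (simp_all add: zero)
qed

end

locale flat_moments = right_quat_inner_space H smul ip
  for H :: "'h::ab_group_add set" and smul :: "'h \<Rightarrow> quat \<Rightarrow> 'h" and ip :: "'h \<Rightarrow> 'h \<Rightarrow> quat" +
  fixes d r :: nat and y :: "'n::finite qword \<Rightarrow> quat" and v :: "'n qword \<Rightarrow> 'h"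
  assumes d_pos: "d \<ge> 1"
    and H_dim: "has_quat_dim H smul r"
    and v_H: "length w \<le> d \<Longrightarrow> v w \<in> H"
    and v_ip: "length u \<le> d \<Longrightarrow> length w \<le> d \<Longrightarrow> ip (v u) (v w) = y (word_star u @ w)"
    and rank: "quat_rank (words_upto (d - 1)) (moment_matrix y) = r"
    and consistent: "scalar_consistent d H smul v"
begin

text \<open>Take r independent columns of the moment matrix of order d - 1. Pairing a relation among
  the vectors v w with each v u gives the same relation among the columns, so these r vectors are
  independent in a space of dimension r.\<close>

lemma spanning_subset:
  obtains B where "B \<subseteq> words_upto (d - 1)" "finite B" "\<And>x. x \<in> H \<Longrightarrow> \<exists>c. x = (\<Sum>w\<in>B. smul (v w) (c w))"
proof -
  let ?W = "words_upto (d - 1) :: 'n qword set"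
  let ?S = "{card B | B. B \<subseteq> ?W \<and>
     (\<forall>c. (\<forall>u\<in>?W. (\<Sum>w\<in>B. moment_matrix y u w * c w) = 0) \<longrightarrow> (\<forall>w\<in>B. c w = 0))}"
  have fin: "finite ?W" by (rule finite_words_upto)
  have "finite ?S"
    by (rule finite_subset[of _ "card ` Pow ?W"]) (use fin in auto)
  \<comment> \<open>The empty set of columns makes the set nonempty, so its \<open>Max\<close> is
    attained by an actual B.\<close>
  moreover have "0 \<in> ?S" by (intro CollectI exI[of _ "{}"]) simp
  ultimately have "Max ?S \<in> ?S" by (intro Max_in) auto
  then have "r \<in> ?S" using rank by (simp only: quat_rank_def)
  then obtain B where B: "B \<subseteq> ?W" "card B = r"
    and ind: "\<And>c. (\<forall>u\<in>?W. (\<Sum>w\<in>B. moment_matrix y u w * c w) = 0) \<Longrightarrow> (\<forall>w\<in>B. c w = 0)"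
    by blast
  have finB: "finite B" using B(1) fin by (rule finite_subset)
  have W: "length w \<le> d" if "w \<in> ?W" for w using that by (auto simp: words_upto_def)
  have BH: "v w \<in> H" if "w \<in> B" for w using that B(1) W v_H by blast
  have "right_independent smul v B"
    unfolding right_independent_def
  proof (intro allI impI)
    fix c assume c: "(\<Sum>w\<in>B. smul (v w) (c w)) = 0"
    have "(\<Sum>w\<in>B. moment_matrix y u w * c w) = 0" if u: "u \<in> ?W" for u
    proof -
      have uH: "v u \<in> H" using u W v_H by blast
      have "(\<Sum>w\<in>B. moment_matrix y u w * c w) = (\<Sum>w\<in>B. ip (v u) (smul (v w) (c w)))"
        using u B(1) W BH uH
        by (intro sum.cong) (auto simp: moment_matrix_def ip_smul_right v_ip[symmetric] subset_iff)
      also have "\<dots> = ip (v u) (\<Sum>w\<in>B. smul (v w) (c w))"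
        using uH BH by (intro ip_sum_right[symmetric] smul_closed) auto
      finally show ?thesis using c uH by (simp add: ip_zero_right)
    qed
    then show "\<forall>w\<in>B. c w = 0" using ind by blast
  qed
  then have "\<exists>c. x = (\<Sum>w\<in>B. smul (v w) (c w))" if "x \<in> H" for x
    using independent_spans[OF H_dim finB B(2), of v x] BH that by blast
  then show ?thesis using that B(1) finB by blast
qed

text \<open>Positivity of d keeps \<open>d - 1\<close> from truncating to 0; the second form matches
  the simplifier's rewriting of \<open>1\<close>.\<close>

lemma words_upto_pred:
  "w \<in> words_upto (d - 1) \<longleftrightarrow> Suc (length w) \<le> d"
  "w \<in> words_upto (d - Suc 0) \<longleftrightarrow> Suc (length w) \<le> d"
  using d_pos by (auto simp: words_upto_def)

text \<open>The difference is orthogonal to a spanning set, hence to itself.\<close>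

lemma vector_eqI:
  assumes "x \<in> H" "z \<in> H" "\<And>u. u \<in> words_upto (d - 1) \<Longrightarrow> ip (v u) x = ip (v u) z"
  shows "x = z"
proof -
  obtain B c where B: "B \<subseteq> words_upto (d - 1)" and c: "x - z = (\<Sum>w\<in>B. smul (v w) (c w))"
    using spanning_subset diff_closed[OF assms(1,2)] by metis
  have BH: "v w \<in> H" if "w \<in> B" for w using that B v_H words_upto_pred by (meson Suc_leD subsetD)
  have xz: "x - z \<in> H" by (rule diff_closed[OF assms(1,2)])
  have "ip (x - z) (x - z) = ip (\<Sum>w\<in>B. smul (v w) (c w)) (x - z)"
    using c by simp
  also have "\<dots> = (\<Sum>w\<in>B. ip (smul (v w) (c w)) (x - z))"
    using BH xz by (intro ip_sum_left smul_closed) auto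
  also have "\<dots> = 0"
    using BH xz B assms by (intro sum.neutral ballI) (simp add: ip_smul_left ip_diff_right subset_iff)
  finally show ?thesis using ip_definite[OF xz] by simp
qed

lemma shift_exists:
  "\<exists>T. right_linear_on H smul T \<and> (\<forall>w\<in>words_upto (d - 1). T (v w) = v (a # w))"
proof -
  (* Characterising T x by its inner products with the spanning vectors makes linearity immediate and
     avoids choosing a basis. *)
  define P where "P = (\<lambda>x z. z \<in> H \<and> (\<forall>u\<in>words_upto (d - 1). ip (v u) z = ip (v (letter_star a # u)) x))"
  have uniq: "z = z'" if "P x z" "P x z'" for x z z'
    using that by (intro vector_eqI) (auto simp: P_def)
  have vH: "v u \<in> H" "v (b # u) \<in> H" if "u \<in> words_upto (d - 1)" for u b
    using that v_H[of u] v_H[of "b # u"] by (auto simp: words_upto_pred)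
  \<comment> \<open>Both inner products are the moment of the word u-star a w; the words a w and
    a-star u have length at most d.\<close>
  have Pv: "P (v w) (v (a # w))" if "w \<in> words_upto (d - 1)" for w
    using that vH by (auto simp: P_def words_upto_pred v_ip)
  have ex: "\<exists>z. P x z" if x: "x \<in> H" for x
  proof -
    obtain B c where B: "B \<subseteq> words_upto (d - 1)" and c: "x = (\<Sum>w\<in>B. smul (v w) (c w))"
      using spanning_subset x by metis
    have BH: "v w \<in> H" "v (a # w) \<in> H" "v (letter_star a # w) \<in> H" if "w \<in> B" for w
      using that B vH by auto
    let ?z = "\<Sum>w\<in>B. smul (v (a # w)) (c w)"
    have "ip (v u) ?z = ip (v (letter_star a # u)) x" if u: "u \<in> words_upto (d - 1)" for u
    proof -
      have "ip (v u) ?z = (\<Sum>w\<in>B. ip (v u) (v (a # w)) * c w)"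
        using vH[OF u] BH by (subst ip_sum_right) (auto simp: ip_smul_right smul_closed)
      also have "\<dots> = (\<Sum>w\<in>B. ip (v (letter_star a # u)) (v w) * c w)"
        using Pv B u by (intro sum.cong) (auto simp: P_def)
      also have "\<dots> = ip (v (letter_star a # u)) x"
        unfolding c using vH[OF u] BH by (subst ip_sum_right) (auto simp: ip_smul_right smul_closed)
      finally show ?thesis .
    qed
    moreover have "?z \<in> H" using BH by (intro sum_closed smul_closed)
    ultimately show ?thesis by (auto simp: P_def)
  qed
  define T where "T = (\<lambda>x. SOME z. P x z)"
  have PT: "P x (T x)" if "x \<in> H" for x
    unfolding T_def by (rule someI_ex[OF ex[OF that]])
  have "right_linear_on H smul T"
    unfolding right_linear_on_def
  proof (intro conjI ballI allI)
    show TH: "T x \<in> H" if "x \<in> H" for x using PT[OF that] by (simp add: P_def)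
    show "T (x + z) = T x + T z" if "x \<in> H" "z \<in> H" for x z
      using PT[OF that(1)] PT[OF that(2)] that
      by (intro uniq[OF PT[OF add_closed[OF that]]]) (auto simp: P_def closed ip_add_right vH)
    show "T (smul x c) = smul (T x) c" if "x \<in> H" for x c
      using PT[OF that] that
      by (intro uniq[OF PT[OF smul_closed[OF that]]]) (auto simp: P_def closed ip_smul_right vH)
  qed
  moreover have "T (v w) = v (a # w)" if "w \<in> words_upto (d - 1)" for w
    by (rule uniq[OF PT[OF vH(1)[OF that]] Pv[OF that]])
  ultimately show ?thesis by blast
qed

section \<open>Shift operators and word operators\<close>

abbreviation X :: "'n letter \<Rightarrow> 'h \<Rightarrow> 'h" where
  "X \<equiv> flat_shift d H smul v"

lemma X_linear: "right_linear_on H smul (X a)"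
  and X_v: "Suc (length w) \<le> d \<Longrightarrow> X a (v w) = v (a # w)"
  using someI_ex[OF shift_exists[of a]] unfolding flat_shift_def words_upto_pred(1)[symmetric]
  by blast+

lemma X_closed: "x \<in> H \<Longrightarrow> X a x \<in> H"
  and X_add: "x \<in> H \<Longrightarrow> z \<in> H \<Longrightarrow> X a (x + z) = X a x + X a z"
  and X_smul: "x \<in> H \<Longrightarrow> X a (smul x c) = smul (X a x) c"
  using X_linear by (auto simp: right_linear_on_def)

text \<open>By sesquilinearity it is enough to compare spanning vectors v u and v w, where both
  sides are the moment of u-star a-star w.\<close>

lemma X_adjoint:
  assumes "x \<in> H" "z \<in> H"
  shows "ip (X a x) z = ip x (X (letter_star a) z)"
proof -
  obtain B where B: "B \<subseteq> words_upto (d - 1)" "\<And>x. x \<in> H \<Longrightarrow> \<exists>c. x = (\<Sum>w\<in>B. smul (v w) (c w))"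
    using spanning_subset by metis
  obtain c where x: "x = (\<Sum>w\<in>B. smul (v w) (c w))" using B(2) assms(1) by blast
  obtain e where z: "z = (\<Sum>w\<in>B. smul (v w) (e w))" using B(2) assms(2) by blast
  have len: "Suc (length w) \<le> d" if "w \<in> B" for w using that B(1) words_upto_pred by blast
  have BH: "v w \<in> H" "X b (v w) \<in> H" if "w \<in> B" for w b
    using len[OF that] v_H[of w] X_closed by auto
  have expand: "ip (\<Sum>u\<in>B. smul (f u) (c u)) (\<Sum>w\<in>B. smul (g w) (e w)) =
      (\<Sum>u\<in>B. \<Sum>w\<in>B. qcnj (c u) * (ip (f u) (g w) * e w))"
    if fg: "\<And>w. w \<in> B \<Longrightarrow> f w \<in> H" "\<And>w. w \<in> B \<Longrightarrow> g w \<in> H" for f g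
  proof -
    have gH: "(\<Sum>w\<in>B. smul (g w) (e w)) \<in> H" using fg by (intro sum_closed smul_closed)
    have "ip (\<Sum>u\<in>B. smul (f u) (c u)) (\<Sum>w\<in>B. smul (g w) (e w)) =
        (\<Sum>u\<in>B. ip (smul (f u) (c u)) (\<Sum>w\<in>B. smul (g w) (e w)))"
      using fg gH by (intro ip_sum_left smul_closed)
    also have "\<dots> = (\<Sum>u\<in>B. qcnj (c u) * ip (f u) (\<Sum>w\<in>B. smul (g w) (e w)))"
      using fg gH by (intro sum.cong refl ip_smul_left)
    also have "\<dots> = (\<Sum>u\<in>B. qcnj (c u) * (\<Sum>w\<in>B. ip (f u) (smul (g w) (e w))))"
      using fg by (intro sum.cong refl arg_cong2[of _ _ _ _ "(*)"] ip_sum_right smul_closed)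
    also have "\<dots> = (\<Sum>u\<in>B. \<Sum>w\<in>B. qcnj (c u) * (ip (f u) (g w) * e w))"
      unfolding sum_distrib_left using fg by (intro sum.cong refl) (simp add: ip_smul_right)
    finally show ?thesis .
  qed
  have "ip (X a (v u)) (v w) = ip (v u) (X (letter_star a) (v w))" if "u \<in> B" "w \<in> B" for u w
    using len[OF that(1)] len[OF that(2)] by (simp add: X_v v_ip)
  then have "(\<Sum>u\<in>B. \<Sum>w\<in>B. qcnj (c u) * (ip (X a (v u)) (v w) * e w)) =
      (\<Sum>u\<in>B. \<Sum>w\<in>B. qcnj (c u) * (ip (v u) (X (letter_star a) (v w)) * e w))"
    by (intro sum.cong) auto
  moreover have "X b x = (\<Sum>w\<in>B. smul (X b (v w)) (c w))" for b
    unfolding x by (rule right_linear_on_sum[OF X_linear BH(1)])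
  moreover have "X b z = (\<Sum>w\<in>B. smul (X b (v w)) (e w))" for b
    unfolding z by (rule right_linear_on_sum[OF X_linear BH(1)])
  moreover have "ip (\<Sum>w\<in>B. smul (X a (v w)) (c w)) z =
      (\<Sum>u\<in>B. \<Sum>w\<in>B. qcnj (c u) * (ip (X a (v u)) (v w) * e w))"
    unfolding z by (rule expand) (rule BH, assumption)+
  moreover have "ip x (\<Sum>w\<in>B. smul (X (letter_star a) (v w)) (e w)) =
      (\<Sum>u\<in>B. \<Sum>w\<in>B. qcnj (c u) * (ip (v u) (X (letter_star a) (v w)) * e w))"
    unfolding x by (rule expand) (rule BH, assumption)+
  ultimately show ?thesis by simp
qed

abbreviation W :: "'n qword \<Rightarrow> 'h \<Rightarrow> 'h" where
  "W \<equiv> flat_word_op d H smul v"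

lemma W_simps [simp]: "W [] x = x" "W (a # w) x = X a (W w x)" "W (u @ w) x = W u (W w x)"
proof -
  show "W [] x = x" "W (a # w) x = X a (W w x)" for a w x by (simp_all add: flat_word_op_def)
  then show "W (u @ w) x = W u (W w x)" by (induction u) simp_all
qed

lemma W_closed: "x \<in> H \<Longrightarrow> W w x \<in> H"
  by (induction w) (simp_all add: X_closed)

lemma W_add: "x \<in> H \<Longrightarrow> z \<in> H \<Longrightarrow> W w (x + z) = W w x + W w z"
  by (induction w) (simp_all add: X_add W_closed)

lemma W_smul: "x \<in> H \<Longrightarrow> W w (smul x c) = smul (W w x) c"
  by (induction w) (simp_all add: X_smul W_closed)

lemma W_linear: "right_linear_on H smul (W w)"
  by (simp add: right_linear_on_def W_closed W_add W_smul)

lemma W_adjoint: "x \<in> H \<Longrightarrow> z \<in> H \<Longrightarrow> ip (W w x) z = ip x (W (word_star w) z)"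
  by (induction w arbitrary: z) (simp_all add: X_adjoint W_closed X_closed)

lemma W_v: "length w \<le> d \<Longrightarrow> W w (v []) = v w"
  by (induction w) (simp_all add: X_v)

text \<open>The Gram relation covers words of length at most d only; a word of length up to 2 d is
  cut after d letters and its first part moved across by the adjoint.\<close>

lemma moment_eq_ip:
  assumes "length w \<le> 2 * d"
  shows "y w = ip (v []) (W w (v []))"
proof -
  define u where "u = word_star (take d w)"
  define u' where "u' = drop d w"
  have w: "w = word_star u @ u'" by (simp add: u_def u'_def)
  have len: "length u \<le> d" "length u' \<le> d" using assms by (auto simp: u_def u'_def)
  have H: "v [] \<in> H" using v_H[of "[]"] by simp
  have "y w = ip (W u (v [])) (W u' (v []))"
    using len by (simp add: w W_v v_ip)
  also have "\<dots> = ip (v []) (W w (v []))"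
    using H by (simp add: w W_adjoint W_closed)
  finally show ?thesis .
qed

section \<open>The representation of polynomials and its descent to functions\<close>

abbreviation R :: "'n qpoly \<Rightarrow> 'h \<Rightarrow> 'h" where
  "R \<equiv> flat_rep d H smul v"

lemma R_superset:
  assumes "finite S" "Poly_Mapping.keys p \<subseteq> S" "x \<in> H"
  shows "R p x = (\<Sum>w\<in>S. smul (W w x) (of_real (Poly_Mapping.lookup p w)))"
  unfolding flat_rep_def using assms
  by (intro sum.mono_neutral_left) (auto simp: in_keys_iff smul_zero_right W_closed)

lemma R_fun_add:
  assumes "x \<in> H"
  shows "R (p + p') x = R p x + R p' x"
proof -
  let ?S = "Poly_Mapping.keys p \<union> Poly_Mapping.keys p' \<union> Poly_Mapping.keys (p + p')"
  have "R t x = (\<Sum>w\<in>?S. smul (W w x) (of_real (Poly_Mapping.lookup t w)))"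
    if "t \<in> {p, p', p + p'}" for t
    using that assms by (intro R_superset) auto
  then show ?thesis using assms by (simp add: lookup_add smul_add_right W_closed sum.distrib)
qed

lemma R_fun_diff: "x \<in> H \<Longrightarrow> R (p - p') x = R p x - R p' x"
  using R_fun_add[of x "p - p'" p'] by simp

lemma R_single: "x \<in> H \<Longrightarrow> R (Poly_Mapping.single w t) x = smul (W w x) (of_real t)"
  using R_superset[of "{w}" "Poly_Mapping.single w t" x] by simp

lemma R_fun_sum: "x \<in> H \<Longrightarrow> R (sum p I) x = (\<Sum>i\<in>I. R (p i) x)"
  by (induction I rule: infinite_finite_induct) (simp_all add: R_fun_add, simp_all add: flat_rep_def)

lemma R_closed: "x \<in> H \<Longrightarrow> R p x \<in> H"
  unfolding flat_rep_def by (intro sum_closed smul_closed W_closed)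

lemma R_add: "x \<in> H \<Longrightarrow> z \<in> H \<Longrightarrow> R p (x + z) = R p x + R p z"
  by (simp add: flat_rep_def W_add smul_add_left W_closed sum.distrib)

lemma R_smul: "x \<in> H \<Longrightarrow> R p (smul x c) = smul (R p x) c"
  unfolding flat_rep_def
  by (subst smul_sum_left) (auto simp: W_smul smul_smul W_closed smul_closed quat_of_real_commute intro!: sum.cong)

text \<open>Scalar consistency enters here: a difference of polynomials with equal evaluations lies
  in the vanishing ideal.\<close>

lemma R_well_defined:
  assumes "\<And>a. qpoly_eval a p = qpoly_eval a p'" "x \<in> H"
  shows "R p x = R p' x"
proof -
  have "p - p' \<in> vanishing_ideal" using assms by (simp add: vanishing_ideal_def qpoly_eval_diff)
  then have "R (p - p') x = 0" using consistent assms(2) by (simp add: scalar_consistent_def)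
  then show ?thesis using assms(2) by (simp add: R_fun_diff)
qed

text \<open>Only the evaluation and the operator of a product matter, so one witness is enough: the
  double sum over concatenated words.\<close>

lemma product_qpoly:
  "\<exists>s. (\<forall>a. qpoly_eval a s = qpoly_eval a p * qpoly_eval a p') \<and> (\<forall>x\<in>H. R s x = R p (R p' x))"
proof (intro exI conjI allI ballI)
  let ?l = Poly_Mapping.lookup
  let ?s = "\<Sum>u\<in>Poly_Mapping.keys p. \<Sum>w\<in>Poly_Mapping.keys p'.
      Poly_Mapping.single (u @ w) (?l p u * ?l p' w)"
  have commute: "of_real s * (a * (of_real t * b)) = of_real s * of_real t * (a * b)" for s t and a b :: quat
    by (metis mult.assoc quat_of_real_commute)
  show "qpoly_eval a ?s = qpoly_eval a p * qpoly_eval a p'" for a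
    unfolding qpoly_eval_sum qpoly_eval_single
    unfolding qpoly_eval_def sum_product by (intro sum.cong refl) (simp add: commute mult.assoc)
  fix x assume x: "x \<in> H"
  have "R p (R p' x) = (\<Sum>u\<in>Poly_Mapping.keys p. smul (W u (R p' x)) (of_real (?l p u)))"
    by (simp add: flat_rep_def)
  also have "\<dots> = (\<Sum>u\<in>Poly_Mapping.keys p. \<Sum>w\<in>Poly_Mapping.keys p'.
      smul (W (u @ w) x) (of_real (?l p u * ?l p' w)))"
  proof (intro sum.cong refl)
    fix u
    have "W u (R p' x) = (\<Sum>w\<in>Poly_Mapping.keys p'. smul (W u (W w x)) (of_real (?l p' w)))"
      unfolding flat_rep_def by (rule right_linear_on_sum[OF W_linear]) (rule W_closed[OF x])
    also have "smul \<dots> (of_real (?l p u)) =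
        (\<Sum>w\<in>Poly_Mapping.keys p'. smul (smul (W u (W w x)) (of_real (?l p' w))) (of_real (?l p u)))"
      using x by (intro smul_sum_left smul_closed W_closed)
    finally show "smul (W u (R p' x)) (of_real (?l p u)) =
        (\<Sum>w\<in>Poly_Mapping.keys p'. smul (W (u @ w) x) (of_real (?l p u * ?l p' w)))"
      using x by (simp add: smul_smul W_closed mult.commute flip: of_real_mult)
  qed
  finally show "R ?s x = R p (R p' x)"
    using x by (simp add: R_fun_sum R_single)
qed

lemma star_qpoly:
  "\<exists>s. (\<forall>a. qpoly_eval a s = qcnj (qpoly_eval a p)) \<and> (\<forall>x\<in>H. \<forall>z\<in>H. ip (R p x) z = ip x (R s z))"
proof (intro exI conjI allI ballI)
  let ?l = Poly_Mapping.lookup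
  let ?s = "\<Sum>w\<in>Poly_Mapping.keys p. Poly_Mapping.single (word_star w) (?l p w)"
  show "qpoly_eval a ?s = qcnj (qpoly_eval a p)" for a
    unfolding qpoly_eval_sum qpoly_eval_single
    unfolding qpoly_eval_def qcnj_sum by (intro sum.cong refl) (simp add: quat_of_real_commute)
  fix x z assume x: "x \<in> H" and z: "z \<in> H"
  have "ip (R p x) z = (\<Sum>w\<in>Poly_Mapping.keys p. ip (smul (W w x) (of_real (?l p w))) z)"
    unfolding flat_rep_def using x z by (intro ip_sum_left smul_closed W_closed)
  also have "\<dots> = (\<Sum>w\<in>Poly_Mapping.keys p. ip x (smul (W (word_star w) z) (of_real (?l p w))))"
    using x z by (intro sum.cong refl)
      (simp add: ip_smul_left ip_smul_right W_closed W_adjoint quat_of_real_commute)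
  also have "\<dots> = ip x (\<Sum>w\<in>Poly_Mapping.keys p. smul (W (word_star w) z) (of_real (?l p w)))"
    using x z by (intro ip_sum_right[symmetric] smul_closed W_closed)
  finally show "ip (R p x) z = ip x (R ?s z)"
    using z by (simp add: R_fun_sum R_single)
qed

definition poly_functions :: "(quat ^ 'n \<Rightarrow> quat) set" where
  "poly_functions = {F. \<exists>p. F = (\<lambda>a. qpoly_eval a p)}"

text \<open>The choice of p is harmless by \<open>R_well_defined\<close>. Working with functions
  turns centrality of real-valued elements into plain commutativity of real numbers with
  quaternions.\<close>

definition function_op :: "(quat ^ 'n \<Rightarrow> quat) \<Rightarrow> 'h \<Rightarrow> 'h" where
  "function_op F = R (SOME p. F = (\<lambda>a. qpoly_eval a p))"

lemma function_op_eq: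
  assumes "F = (\<lambda>a. qpoly_eval a p)" "x \<in> H"
  shows "function_op F x = R p x"
proof -
  have "F = (\<lambda>a. qpoly_eval a (SOME p. F = (\<lambda>a. qpoly_eval a p)))"
    by (rule someI) (rule assms(1))
  then have "qpoly_eval a (SOME p. F = (\<lambda>a. qpoly_eval a p)) = qpoly_eval a p" for a
    using assms(1) by metis
  then show ?thesis unfolding function_op_def using assms(2) by (rule R_well_defined)
qed

sublocale quat_function_rep H smul ip poly_functions function_op r
proof
  show "has_quat_dim H smul r" by (rule H_dim)
  have const: "(\<lambda>_. of_real t) = (\<lambda>a. qpoly_eval a (Poly_Mapping.single [] t))" for t
    by (simp add: qpoly_eval_single)
  show "(\<lambda>_. of_real t) \<in> poly_functions" for t
    using const unfolding poly_functions_def by blast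
  show "function_op (\<lambda>_. of_real t) x = smul x (of_real t)" if "x \<in> H" for t x
    using function_op_eq[OF const that] R_single[OF that, of "[]" t] by simp
  fix F assume "F \<in> poly_functions"
  then obtain p where p: "F = (\<lambda>a. qpoly_eval a p)" by (auto simp: poly_functions_def)
  note op = function_op_eq[OF p]
  show "function_op F x \<in> H" if "x \<in> H" for x
    using that by (simp add: op R_closed)
  show "function_op F (x + z) = function_op F x + function_op F z" if "x \<in> H" "z \<in> H" for x z
    using that by (simp add: op closed R_add)
  show "function_op F (smul x c) = smul (function_op F x) c" if "x \<in> H" for x c
    using that by (simp add: op closed R_smul)
  obtain s where s: "\<And>a. qpoly_eval a s = qcnj (qpoly_eval a p)"
      "\<And>x z. x \<in> H \<Longrightarrow> z \<in> H \<Longrightarrow> ip (R p x) z = ip x (R s z)"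
    using star_qpoly by blast
  have s': "(\<lambda>a. qcnj (F a)) = (\<lambda>a. qpoly_eval a s)" by (simp add: p s)
  show "(\<lambda>a. qcnj (F a)) \<in> poly_functions" using s' by (auto simp: poly_functions_def)
  show "ip (function_op F x) z = ip x (function_op (\<lambda>a. qcnj (F a)) z)" if "x \<in> H" "z \<in> H" for x z
    using that s(2) by (simp add: op function_op_eq[OF s'])
  fix G assume "G \<in> poly_functions"
  then obtain p' where p': "G = (\<lambda>a. qpoly_eval a p')" by (auto simp: poly_functions_def)
  have sum: "(\<lambda>a. F a + G a) = (\<lambda>a. qpoly_eval a (p + p'))" by (simp add: p p' qpoly_eval_add)
  show "(\<lambda>a. F a + G a) \<in> poly_functions" using sum by (auto simp: poly_functions_def)
  show "function_op (\<lambda>a. F a + G a) x = function_op F x + function_op G x" if "x \<in> H" for x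
    using that by (simp add: op function_op_eq[OF sum] function_op_eq[OF p'] R_fun_add)
  obtain t where t: "\<And>a. qpoly_eval a t = qpoly_eval a p * qpoly_eval a p'"
      "\<And>x. x \<in> H \<Longrightarrow> R t x = R p (R p' x)"
    using product_qpoly by blast
  have t': "(\<lambda>a. F a * G a) = (\<lambda>a. qpoly_eval a t)" by (simp add: p p' t)
  show "(\<lambda>a. F a * G a) \<in> poly_functions" using t' by (auto simp: poly_functions_def)
  show "function_op (\<lambda>a. F a * G a) x = function_op F (function_op G x)" if "x \<in> H" for x
    using that t(2) by (simp add: op function_op_eq[OF t'] function_op_eq[OF p'] R_closed)
qed

section \<open>Points and weights from eigenvectors\<close>

lemma letter_eigenvector:
  assumes "\<And>F. F \<in> poly_functions \<Longrightarrow> \<exists>c. function_op F f = smul f c" "f \<in> H"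
  shows "\<exists>c. X a f = smul f c"
proof -
  have "\<exists>c. function_op (\<lambda>q. qpoly_eval q (Poly_Mapping.single [a] 1)) f = smul f c"
    using assms(1) by (auto simp: poly_functions_def)
  moreover have "function_op (\<lambda>q. qpoly_eval q (Poly_Mapping.single [a] 1)) f = X a f"
    using function_op_eq[OF refl assms(2)] R_single[OF assms(2), of "[a]" 1]
    by (simp add: smul_one X_closed assms(2))
  ultimately show ?thesis by simp
qed

text \<open>The point is read off from the component g = f c and not from f, since the factor c
  conjugates all eigenvalues. The adjoint relation makes the eigenvalue of a starred letter the
  conjugate one, so the eigenvalues are an evaluation at a point; right linearity multiplies them in
  the order of the word.\<close>

lemma joint_eigenvector_point:
  assumes f: "f \<in> H" and ev: "\<And>F. F \<in> poly_functions \<Longrightarrow> \<exists>c. function_op F f = smul f c"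
    and g: "g = smul f c" "g \<noteq> 0"
  shows "\<exists>q. \<forall>w. W w g = smul g (word_eval q w)"
proof -
  have gH: "g \<in> H" using f g by (simp add: smul_closed)
  have "c \<noteq> 0" using f g by (auto simp: smul_zero_right)
  have "\<exists>e. X a g = smul g e" for a
  proof -
    obtain e where "X a f = smul f e" using letter_eigenvector[OF ev f] by blast
    then have "X a g = smul f (e * c)" using f g by (simp add: X_smul smul_smul)
    also have "\<dots> = smul g (inverse c * e * c)"
      using f g \<open>c \<noteq> 0\<close> by (simp add: smul_smul mult.assoc[symmetric])
    finally show ?thesis by blast
  qed
  then obtain e where e: "\<And>a. X a g = smul g (e a)" by metis
  define q where "q = (\<chi> i. e (Q i))"
  have star: "e (letter_star a) = qcnj (e a)" for a
  proof -
    define s where "s = qRe (ip g g)"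
    have s: "ip g g = of_real s" "s \<noteq> 0"
      using ip_self_real[OF gH] ip_self_pos[OF gH g(2)] by (auto simp: s_def)
    have "qcnj (e a) * of_real s = of_real s * e (letter_star a)"
      using X_adjoint[OF gH gH, of a] gH s(1) by (simp add: e ip_smul_left ip_smul_right)
    then have "of_real s * qcnj (e a) = of_real s * e (letter_star a)"
      by (simp add: quat_of_real_commute)
    then show ?thesis using s(2) by simp
  qed
  have le: "e a = letter_eval q a" for a
  proof (cases a)
    case (Qbar i)
    then show ?thesis using star[of "Q i"] by (simp add: q_def)
  qed (simp add: q_def)
  have "W w g = smul g (word_eval q w)" for w
    by (induction w) (simp_all add: gH smul_one X_smul e smul_smul le)
  then show ?thesis by blast
qed

text \<open>Orthogonality leaves only <g i, g i> times the evaluation in <v [], W w (v [])>. The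
  points may still coincide here.\<close>

theorem finite_moment_decomposition:
  obtains I :: "nat set" and q l where "finite I" "card I \<le> r" "\<And>i. i \<in> I \<Longrightarrow> 0 < l i"
    "\<And>w. length w \<le> 2 * d \<Longrightarrow> y w = (\<Sum>i\<in>I. of_real (l i) * word_eval (q i) w)"
proof -
  obtain n f where n: "n \<le> r" and fH: "\<And>i. i < n \<Longrightarrow> f i \<in> H"
    and ev: "\<And>i F. i < n \<Longrightarrow> F \<in> poly_functions \<Longrightarrow> \<exists>c. function_op F (f i) = smul (f i) c"
    and orth: "\<And>i j. i < n \<Longrightarrow> j < n \<Longrightarrow> i \<noteq> j \<Longrightarrow> ip (f i) (f j) = 0"
    and span: "\<And>x. x \<in> H \<Longrightarrow> \<exists>c. x = (\<Sum>i<n. smul (f i) (c i))"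
    by (rule eigenvector_decomposition) blast
  obtain c where c: "v [] = (\<Sum>i<n. smul (f i) (c i))" using span[of "v []"] v_H[of "[]"] by auto
  define g where "g = (\<lambda>i. smul (f i) (c i))"
  \<comment> \<open>Discarding zero components makes all weights strictly positive.\<close>
  define I where "I = {i. i < n \<and> g i \<noteq> 0}"
  have gH: "g i \<in> H" if "i \<in> I" for i using that fH by (auto simp: I_def g_def smul_closed)
  have finI: "finite I" by (simp add: I_def)
  have v0: "v [] = (\<Sum>i\<in>I. g i)"
    unfolding c g_def[symmetric] I_def by (rule sum.mono_neutral_right) (auto simp: g_def)
  have "\<forall>i\<in>I. \<exists>q. \<forall>w. W w (g i) = smul (g i) (word_eval q w)"
    using joint_eigenvector_point[OF fH ev] by (auto simp: I_def g_def)
  then obtain q where q: "\<And>i w. i \<in> I \<Longrightarrow> W w (g i) = smul (g i) (word_eval (q i) w)" by metis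
  define l where "l = (\<lambda>i. qRe (ip (g i) (g i)))"
  have l: "0 < l i" "ip (g i) (g i) = of_real (l i)" if "i \<in> I" for i
    using ip_self_pos[OF gH[OF that]] ip_self_real[OF gH[OF that]] that by (auto simp: l_def I_def)
  have gorth: "ip (g i) (g j) = 0" if "i \<in> I" "j \<in> I" "i \<noteq> j" for i j
    using that fH orth by (auto simp: I_def g_def ip_smul_left ip_smul_right smul_closed)
  have "y w = (\<Sum>i\<in>I. of_real (l i) * word_eval (q i) w)" if w: "length w \<le> 2 * d" for w
  proof -
    have v0H: "v [] \<in> H" using v_H[of "[]"] by simp
    have "W w (v []) = (\<Sum>i\<in>I. W w (g i))"
      using right_linear_on_sum[where T = "W w" and g = g and I = I and c = "\<lambda>_. 1"] W_linear gH
      by (simp add: v0 smul_one W_closed)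
    also have "\<dots> = (\<Sum>i\<in>I. smul (g i) (word_eval (q i) w))" using q by simp
    finally have "y w = ip (v []) (\<Sum>i\<in>I. smul (g i) (word_eval (q i) w))"
      using moment_eq_ip[OF w] by simp
    also have "\<dots> = (\<Sum>i\<in>I. ip (v []) (smul (g i) (word_eval (q i) w)))"
      using v0H gH by (intro ip_sum_right smul_closed)
    also have "\<dots> = (\<Sum>i\<in>I. of_real (l i) * word_eval (q i) w)"
    proof (intro sum.cong refl)
      fix i assume i: "i \<in> I"
      have "ip (v []) (g i) = (\<Sum>j\<in>I. ip (g j) (g i))"
        unfolding v0 using gH i by (intro ip_sum_left)
      also have "\<dots> = (\<Sum>j\<in>I. if j = i then of_real (l i) else 0)"
        using gorth l(2) i by (intro sum.cong) auto
      also have "\<dots> = of_real (l i)" using i finI by simp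
      finally show "ip (v []) (smul (g i) (word_eval (q i) w)) = of_real (l i) * word_eval (q i) w"
        using v0H gH[OF i] by (simp add: ip_smul_right)
    qed
    finally show ?thesis .
  qed
  moreover have "card I \<le> r"
  proof -
    have "card I \<le> card {..<n}" by (rule card_mono) (auto simp: I_def)
    with n show ?thesis by simp
  qed
  ultimately show ?thesis using that finI l(1) by blast
qed

end


section \<open>Atomic measures\<close>

lemma continuous_on_qcnj: "continuous_on S qcnj"
proof -
  have "linear qcnj" by (rule linearI) (simp_all add: quat_eq_iff)
  then show ?thesis by (rule linear_continuous_on[OF linear_conv_bounded_linear[THEN iffD1]])
qed

lemma continuous_on_letter_eval: "continuous_on S (\<lambda>a :: quat ^ 'n::finite. letter_eval a b)"
  by (cases b) (auto intro!: continuous_intros continuous_on_compose2[OF continuous_on_qcnj[of UNIV]])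

lemma continuous_on_word_eval: "continuous_on S (\<lambda>a :: quat ^ 'n::finite. word_eval a w)"
  by (induction w) (auto intro!: continuous_intros continuous_on_letter_eval)

text \<open>As the image under q of a weighted counting measure on indices, the atomic measure
  inherits total mass and integrals from finite sums.\<close>

lemma atomic_measure_eq_distr:
  "atomic_measure N l q = distr (point_measure {..<N} (\<lambda>k. ennreal (l k))) borel q"
proof -
  let ?D = "distr (point_measure {..<N} (\<lambda>k. ennreal (l k))) borel q"
  have "(\<Sum>k<N. ennreal (l k) * emeasure (return borel (q k)) A) = emeasure ?D A" if "A \<in> sets borel" for A
  proof -
    have "emeasure ?D A = emeasure (point_measure {..<N} (\<lambda>k. ennreal (l k))) (q -` A \<inter> {..<N})"
      using that by (simp add: emeasure_distr space_point_measure)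
    also have "\<dots> = (\<Sum>k\<in>q -` A \<inter> {..<N}. ennreal (l k))"
      by (simp add: emeasure_point_measure_finite)
    also have "\<dots> = (\<Sum>k<N. ennreal (l k) * indicator A (q k))"
      by (rule sum.mono_neutral_cong_left) (auto simp: indicator_def)
    finally show ?thesis using that by simp
  qed
  then have "atomic_measure N l q = measure_of UNIV (sets borel) (emeasure ?D)"
    unfolding atomic_measure_def by (intro measure_of_eq) (auto simp: sets.sigma_sets_eq[of borel, simplified])
  also have "\<dots> = ?D" using measure_of_of_measure[of ?D] by simp
  finally show ?thesis .
qed

lemma prob_space_atomic_measure:
  assumes "\<And>k. k < N \<Longrightarrow> 0 \<le> l k" "(\<Sum>k<N. l k) = 1"
  shows "prob_space (atomic_measure N l q)"
proof -
  have "emeasure (point_measure {..<N} (\<lambda>k. ennreal (l k))) {..<N} = (\<Sum>k<N. ennreal (l k))"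
    by (simp add: emeasure_point_measure_finite)
  also have "\<dots> = ennreal (\<Sum>k<N. l k)" using assms by (intro sum_ennreal) auto
  finally have "prob_space (point_measure {..<N} (\<lambda>k. ennreal (l k)))"
    using assms by (intro prob_spaceI) (simp add: space_point_measure)
  then show ?thesis unfolding atomic_measure_eq_distr by (rule prob_space.prob_space_distr) simp
qed

text \<open>Weights must be nonnegative because \<open>ennreal\<close> sends negative reals to
  0.\<close>

lemma atomic_measure_integral:
  fixes f :: "quat ^ 'n::finite \<Rightarrow> quat"
  assumes "\<And>k. k < N \<Longrightarrow> 0 \<le> l k" "f \<in> borel_measurable borel"
  shows "integrable (atomic_measure N l q) f"
    "(\<integral>a. f a \<partial>atomic_measure N l q) = (\<Sum>k<N. of_real (l k) * f (q k))"
proof -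
  have q: "q \<in> measurable (point_measure {..<N} (\<lambda>k. ennreal (l k))) borel" by simp
  have int: "integrable (point_measure {..<N} (\<lambda>k. ennreal (l k))) (\<lambda>k. f (q k))"
    by (rule integrable_point_measure_finite) simp
  then show "integrable (atomic_measure N l q) f"
    unfolding atomic_measure_eq_distr integrable_distr_eq[OF q assms(2)] .
  show "(\<integral>a. f a \<partial>atomic_measure N l q) = (\<Sum>k<N. of_real (l k) * f (q k))"
    unfolding atomic_measure_eq_distr integral_distr[OF q assms(2)]
    using assms(1) by (subst lebesgue_integral_point_measure_finite) (auto simp: scaleR_conv_of_real intro!: sum.cong)
qed

text \<open>Weights are added over the fibres of q, which are nonempty, so the sums stay positive.
  The identity holds for all f with the same atoms, so it serves all words at once.\<close>

lemma merge_atoms: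
  fixes l :: "'i \<Rightarrow> real" and q :: "'i \<Rightarrow> 'a"
  assumes "finite I" "\<And>i. i \<in> I \<Longrightarrow> 0 < l i"
  obtains N q' l' where "N \<le> card I" "inj_on q' {..<N}" "\<And>k. k < N \<Longrightarrow> 0 < l' k"
    "\<And>f :: 'a \<Rightarrow> quat. (\<Sum>i\<in>I. of_real (l i) * f (q i)) = (\<Sum>k<N. of_real (l' k) * f (q' k))"
proof -
  obtain e where e: "bij_betw e {..<card (q ` I)} (q ` I)"
    using ex_bij_betw_nat_finite[of "q ` I"] assms(1) by (auto simp: atLeast0LessThan)
  define L where "L = (\<lambda>x. \<Sum>i\<in>{i \<in> I. q i = x}. l i)"
  have "L x > 0" if "x \<in> q ` I" for x
    unfolding L_def using that assms by (intro sum_pos) auto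
  then have pos: "0 < L (e k)" if "k < card (q ` I)" for k
    using bij_betw_apply[OF e] that by blast
  have "(\<Sum>i\<in>I. of_real (l i) * f (q i)) = (\<Sum>k<card (q ` I). of_real (L (e k)) * f (e k))"
    for f :: "'a \<Rightarrow> quat"
  proof -
    have "(\<Sum>i\<in>I. of_real (l i) * f (q i)) = (\<Sum>x\<in>q ` I. \<Sum>i\<in>{i \<in> I. q i = x}. of_real (l i) * f (q i))"
      by (rule sum.image_gen[OF assms(1)])
    also have "\<dots> = (\<Sum>x\<in>q ` I. of_real (L x) * f x)"
      by (intro sum.cong refl) (simp add: L_def sum_distrib_right)
    also have "\<dots> = (\<Sum>k<card (q ` I). of_real (L (e k)) * f (e k))"
      by (rule sum.reindex_bij_betw[OF e, symmetric])
    finally show ?thesis .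
  qed
  moreover have "inj_on e {..<card (q ` I)}" using e by (simp add: bij_betw_def)
  moreover have "card (q ` I) \<le> card I" by (rule card_image_le[OF assms(1)])
  ultimately show ?thesis using that[of "card (q ` I)" e "\<lambda>k. L (e k)"] pos by blast
qed

theorem theorem5p12:
  fixes d r :: nat
    and y :: "'n::finite qword \<Rightarrow> quat"
    and H :: "'h::ab_group_add set"
    and smul :: "'h \<Rightarrow> quat \<Rightarrow> 'h"
    and ip :: "'h \<Rightarrow> 'h \<Rightarrow> quat"
    and v :: "'n qword \<Rightarrow> 'h"
  assumes "d \<ge> 1"
    and "pseudo_moment_sequence d y"
    and "y [] = 1"
    and "quat_psd (words_upto d) (moment_matrix y)"
    and "quat_rank (words_upto d) (moment_matrix y) = r"
    and "quat_rank (words_upto (d - 1)) (moment_matrix y) = r"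
    and "flat_space d r y H smul ip v"
    and "scalar_consistent d H smul v"
  shows "\<exists>(N::nat) (q :: nat \<Rightarrow> quat ^ 'n) (l :: nat \<Rightarrow> real).
    N \<le> r \<and> inj_on q {..<N} \<and> (\<forall>k<N. 0 < l k) \<and> (\<Sum>k<N. l k) = 1 \<and>
    prob_space (atomic_measure N l q) \<and> represents d (atomic_measure N l q) y"
proof -
  have inner: "right_quat_inner_space H smul ip" and dim: "has_quat_dim H smul r"
    and vH: "\<And>w. length w \<le> d \<Longrightarrow> v w \<in> H"
    and gram: "\<And>u w. length u \<le> d \<Longrightarrow> length w \<le> d \<Longrightarrow> ip (v u) (v w) = y (word_star u @ w)"
    using assms(7) by (simp_all add: flat_space_def words_upto_def)
  interpret flat_moments H smul ip d r y v
    using inner dim vH gram assms(1,6,8) by (intro flat_moments.intro flat_moments_axioms.intro)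
  obtain I :: "nat set" and q l where I: "finite I" "card I \<le> r" "\<And>i. i \<in> I \<Longrightarrow> 0 < l i"
    and y: "\<And>w. length w \<le> 2 * d \<Longrightarrow> y w = (\<Sum>i\<in>I. of_real (l i) * word_eval (q i) w)"
    by (rule finite_moment_decomposition) blast
  obtain N q' l' where N: "N \<le> card I" "inj_on q' {..<N}" "\<And>k. k < N \<Longrightarrow> 0 < l' k"
    and merge: "\<And>f :: quat ^ 'n \<Rightarrow> quat.
      (\<Sum>i\<in>I. of_real (l i) * f (q i)) = (\<Sum>k<N. of_real (l' k) * f (q' k))"
    by (rule merge_atoms[where q = q and l = l, OF I(1)]) (erule I(3), rule that)
  have y': "y w = (\<Sum>k<N. of_real (l' k) * word_eval (q' k) w)" if "length w \<le> 2 * d" for w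
    using y[OF that] merge[of "\<lambda>a. word_eval a w"] by simp
  \<comment> \<open>The empty word evaluates to 1 everywhere, so \<open>y [] = 1\<close> is the
    total mass.\<close>
  have "of_real (\<Sum>k<N. l' k) = (of_real 1 :: quat)"
    using y'[of "[]"] assms(3) by simp
  then have one: "(\<Sum>k<N. l' k) = 1" by (simp only: of_real_eq_iff)
  have nonneg: "\<And>k. k < N \<Longrightarrow> 0 \<le> l' k" using N(3) by (simp add: less_imp_le)
  have "represents d (atomic_measure N l' q') y"
    unfolding represents_def
  proof (intro ballI conjI)
    fix w :: "'n qword" assume w: "w \<in> words_upto (2 * d)"
    have meas: "(\<lambda>a. word_eval a w) \<in> borel_measurable borel"
      by (rule borel_measurable_continuous_onI[OF continuous_on_word_eval])
    note int = atomic_measure_integral[where q = q', OF nonneg meas]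
    show "integrable (atomic_measure N l' q') (\<lambda>a. word_eval a w)" using int(1) by simp
    show "y w = (\<integral>a. word_eval a w \<partial>atomic_measure N l' q')"
      using int(2) y'[of w] w by (simp add: words_upto_def)
  qed
  then show ?thesis
    using N I(2) one prob_space_atomic_measure[OF nonneg one] by (meson le_trans)
qed

end
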